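(* Let $p\ge1$ be an integer. There does not exist a regular language of geodesics for $F(p+1)$ with respect to $X=\{x_0,\dots,x_p\}$; that is, there is no regular language $L$ over the alphabet $X\cup X^{-1}$ such that every word in $L$ is geodesic with respect to $X$ and every element of $F(p+1)$ is represented by at least one word of $L$.
   Context: For an integer $p\ge1$, $F(p+1)$ is the group of piecewise-linear orientation-preserving homeomorphisms of $[0,1]$ with finitely many breakpoints, all in $\mathbb{Z}[\frac1{p+1}]$, and with slopes in the multiplicative group generated by $p+1$; the product is $fg=f\circ g$. Standard finite generating set $X=\{x_0,\dots,x_p\}$: for $0\le i\le p-1$, in the domain divide $[0,1]$ into $p+1$ equal intervals and divide the last of these again into $p+1$ equal intervals; in the range divide $[0,1]$ into $p+1$ equal intervals and divide the $(i+1)$-st (from the left) of these again into $p+1$ equal intervals; $x_i$ maps the $j$-th domain interval affinely and increasingly onto the $j$-th range interval, for each $j=1,\dots,2p+1$. The generator $x_p$ is the identity on $[0,\frac p{p+1}]$ and $x_p(t)=\frac{p+x_0((p+1)t-p)}{p+1}$ on $[\frac p{p+1},1]$. A word over $X\cup X^{-1}$ is geodesic if its length equals the word length (with respect to $X$) of the element it represents. *)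

theory Defs
  imports "HOL-Analysis.Analysis" "HOL-Algebra.Bij"
begin

definition Z_inverted :: "nat \<Rightarrow> real set" where
  "Z_inverted n = {of_int a / of_nat n ^ k | (a::int) (k::nat). True}"

text \<open>
  The finite set \<open>B\<close> may properly contain the set of breakpoints of \<open>f\<close>. Requiring \<open>f\<close> to be
  affine on the closed interval between two neighbouring points of \<open>B\<close> includes continuity.
\<close>
definition piecewise_linear_F :: "nat \<Rightarrow> (real \<Rightarrow> real) \<Rightarrow> bool" where
  "piecewise_linear_F n f \<longleftrightarrow>
     (\<exists>B. finite B \<and> B \<subseteq> Z_inverted n \<and>
        (\<forall>a b. 0 \<le> a \<longrightarrow> a < b \<longrightarrow> b \<le> 1 \<longrightarrow> {a<..<b} \<inter> B = {} \<longrightarrow>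
           (\<exists>(k::int) c. \<forall>t\<in>{a..b}. f t = of_nat n powi k * t + c)))"

text \<open>
  Homeomorphisms of $[0,1]$ are functions that are \<open>undefined\<close> outside $[0,1]$, so that equality of
  functions is equality on $[0,1]$. The product of \<open>f\<close> and \<open>g\<close> in \<open>BijGroup {0..1}\<close> is
  \<open>f \<circ> g\<close> on $[0,1]$.
\<close>
definition F_group :: "nat \<Rightarrow> (real \<Rightarrow> real) monoid" where
  "F_group n = (BijGroup {0..1})
     \<lparr>carrier := {f \<in> Bij {0..1}. (\<exists>g. homeomorphism {0..1} {0..1} f g) \<and>
                    strict_mono_on {0..1} f \<and> piecewise_linear_F n f}\<rparr>"

text \<open>
  The points \<open>subdivision p i 0 < \<dots> < subdivision p i (2 * p + 1)\<close> are the endpoints of the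
  intervals obtained by dividing $[0,1]$ into $p+1$ equal intervals and the $(i+1)$-st of these
  again into $p+1$ equal intervals, for \<open>i \<le> p\<close>.
\<close>
definition subdivision :: "nat \<Rightarrow> nat \<Rightarrow> nat \<Rightarrow> real" where
  "subdivision p i j =
     (if j \<le> i then real j / real (p + 1)
      else if j \<le> i + p + 1 then real i / real (p + 1) + real (j - i) / real (p + 1) ^ 2
      else real (j - p) / real (p + 1))"

text \<open>
  The intervals are numbered from \<open>0\<close>: below, \<open>t\<close> lies in \<open>{subdivision p p j..subdivision p p (j + 1)}\<close>.
\<close>
definition caret_map :: "nat \<Rightarrow> nat \<Rightarrow> real \<Rightarrow> real" where
  "caret_map p i = (\<lambda>t\<in>{0..1}.
     let j = (LEAST j. t \<le> subdivision p p (j + 1));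
         a = subdivision p p j; b = subdivision p p (j + 1);
         c = subdivision p i j; d = subdivision p i (j + 1)
     in c + (t - a) * (d - c) / (b - a))"

definition F_gen :: "nat \<Rightarrow> nat \<Rightarrow> real \<Rightarrow> real" where
  "F_gen p i =
     (if i < p then caret_map p i
      else (\<lambda>t\<in>{0..1}. if t \<le> real p / real (p + 1) then t
              else (real p + caret_map p 0 (real (p + 1) * t - real p)) / real (p + 1)))"

definition F_gens :: "nat \<Rightarrow> (real \<Rightarrow> real) set" where
  "F_gens p = F_gen p ` {0..p}"

text \<open>
  The letters of a word are elements of the group, and so is the alphabet \<open>sym_gens G X\<close>. For
  \<open>F_gens p\<close> with \<open>p \<ge> 1\<close> this is the same as using formal letters and formal inverses, because
  the generators and their inverses are pairwise distinct.
\<close>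
definition sym_gens :: "('a, 'b) monoid_scheme \<Rightarrow> 'a set \<Rightarrow> 'a set" where
  "sym_gens G X = X \<union> m_inv G ` X"

definition word_value :: "('a, 'b) monoid_scheme \<Rightarrow> 'a list \<Rightarrow> 'a" where
  "word_value G w = foldr (mult G) w (one G)"

definition word_length :: "('a, 'b) monoid_scheme \<Rightarrow> 'a set \<Rightarrow> 'a \<Rightarrow> nat" where
  "word_length G X g =
     (LEAST n. \<exists>w \<in> lists (sym_gens G X). length w = n \<and> word_value G w = g)"

definition geodesic_word :: "('a, 'b) monoid_scheme \<Rightarrow> 'a set \<Rightarrow> 'a list \<Rightarrow> bool" where
  "geodesic_word G X w \<longleftrightarrow>
     w \<in> lists (sym_gens G X) \<and> length w = word_length G X (word_value G w)"

text \<open>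
  Languages over the alphabet \<open>A\<close> accepted by a deterministic finite automaton; naming the states
  by natural numbers is no restriction since there are only finitely many.
\<close>
definition regular_language :: "'a set \<Rightarrow> 'a list set \<Rightarrow> bool" where
  "regular_language A L \<longleftrightarrow>
     (\<exists>(Q::nat set) q0 \<delta> Acc.
        finite Q \<and> q0 \<in> Q \<and> Acc \<subseteq> Q \<and> (\<forall>q\<in>Q. \<forall>a\<in>A. \<delta> q a \<in> Q) \<and>
        L = {w \<in> lists A. foldl \<delta> q0 w \<in> Acc})"

end

theory Submission imports Defs begin

text \<open>
  Write $n = p + 1$. The proof finds elements of $F(n)$ whose geodesics are all forced to end in a long
  power of $x_0$ or of $x_0^{-1}$, both endings being possible (\<^emph>\<open>seesaw elements\<close>). The pumping lemma
  then lengthens the final power and produces a word that is longer than the element requires.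

  The necessary lower bound for word length is obtained by watching how the letters of a word move the
  points of $[0,1]$. There is a sequence $\dots < z_{-1} < z_0 < z_1 < \dots$ in $(0,1)$, the
  \<^emph>\<open>spine\<close>, with $x_0(z_j) = z_{j-1}$ for all $j$, and each of $x_1, \dots, x_p$ is the identity to the
  left of $z_0$ and agrees with $x_0$ to the right of $z_2$. Give a point the label $0$ if it is some $z_j$
  with $j \le 0$, the label $1$ if it is some $z_j$ with $j \ge 1$, and the label $2$ otherwise. A
  generator changes the label of a single point, namely of $z_1$, and changes it by at most $1$; likewise
  its inverse changes only the label of the image of $z_1$. Hence every letter of a word pays for a change
  of label at one point only, and the length of the word is at least the sum, over all points $t$, of the
  total variation of the label along the orbit of $t$ (\<open>sum_variation_le_length\<close>).

  The seesaw element is $g = CR = RC$ with $C = x_0^k (x_1^{-1} x_0^{-1} x_1) x_0^{-(k-1)}$, supported far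
  to the left of $z_1$, and $R = (x_0^{-1} x_1^{-1})^k x_0^k$, supported to the right of $z_1$. The
  words $CR$ and $RC$ have length $5k+2$; one ends in $x_0^k$ and the other in $x_0^{-(k-1)}$. On the
  other hand any word for $g$ has to change many labels. To create the action of $C$ the points $z_j$
  with $1 - k \le j \le 0$ must leave the label $0$ at some time. For the points $z_j$ with
  $1 \le j \le k$ there is an arithmetic reason for visiting the label $0$: let $c_j$ be the point of
  $(z_j, z_{j+1})$ that corresponds to $x_1(z_1) \in (z_0, z_1)$. As long as the first point of the pair
  is not moved to $z_0$, the pair $(z_j, c_j)$ remains at relative position $(0, p/n)$ in a
  standard $n$-adic interval (\<open>child_pair_visits_spine_0\<close>), but $g$ maps it to a pair of consecutive
  points of the spine. Adding up gives the bound $5k + 2$ (\<open>length_ge\<close>), so a geodesic cannot afford any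
  further change of label. If the letter in front of a final power of $x_0^{\pm 1}$ were different from
  $x_0^{\pm 1}$, it would cause such a change; so every geodesic ends in $x_0^{k-2}$ or in
  $x_0^{-(k-2)}$ (\<open>geodesic_suffix\<close>). If $k$ exceeds the number of states of an automaton by $3$,
  pumping gives a geodesic of length $5k + 2 + d$ for $g x_0^{\pm d}$ with some $1 \le d \le k - 1$, whereas
  cancelling $x_0^{\pm d}$ at the end of the other word for $g$ represents that element by a word of
  length $5k + 2 - d$.
\<close>

section \<open>Homeomorphisms that preserve the breakpoint set\<close>

lemma F_group_simps:
  "carrier (F_group n) = {f \<in> Bij {0..1}. (\<exists>g. homeomorphism {0..1} {0..1} f g) \<and>
     strict_mono_on {0..1} f \<and> piecewise_linear_F n f}"
  "mult (F_group n) = (\<lambda>g \<in> Bij {0..1}. \<lambda>f \<in> Bij {0..1}. compose {0..1} g f)"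
  "one (F_group n) = (\<lambda>t\<in>{0..1}. t)"
  by (simp_all add: F_group_def BijGroup_def)

lemma Z_inverted_iff: "t \<in> Z_inverted n \<longleftrightarrow> (\<exists>(a::int) k. t = of_int a / of_nat n ^ k)"
  by (auto simp: Z_inverted_def)

lemma Z_inverted_of_int: "of_int a \<in> Z_inverted n"
  unfolding Z_inverted_iff by (rule exI[of _ a], rule exI[of _ 0]) simp

lemma Z_inverted_add:
  assumes "s \<in> Z_inverted n" "t \<in> Z_inverted n" "n > 0"
  shows "s + t \<in> Z_inverted n"
proof -
  obtain a k b l where "s = of_int a / of_nat n ^ k" "t = of_int b / of_nat n ^ l"
    using assms(1,2) by (auto simp: Z_inverted_iff)
  then have "s + t = of_int (a * int n ^ l + b * int n ^ k) / of_nat n ^ (k + l)"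
    using \<open>n > 0\<close> by (simp add: add_divide_distrib power_add)
  then show ?thesis
    unfolding Z_inverted_iff by blast
qed

lemma Z_inverted_mult:
  assumes "s \<in> Z_inverted n" "t \<in> Z_inverted n"
  shows "s * t \<in> Z_inverted n"
proof -
  obtain a k b l where "s = of_int a / of_nat n ^ k" "t = of_int b / of_nat n ^ l"
    using assms by (auto simp: Z_inverted_iff)
  then have "s * t = of_int (a * b) / of_nat n ^ (k + l)"
    by (simp add: power_add)
  then show ?thesis
    unfolding Z_inverted_iff by blast
qed

lemma Z_inverted_diff:
  assumes "s \<in> Z_inverted n" "t \<in> Z_inverted n" "n > 0"
  shows "s - t \<in> Z_inverted n"
  using Z_inverted_add[OF assms(1) Z_inverted_mult[OF Z_inverted_of_int[of "-1"] assms(2)] assms(3)]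
  by simp

lemma Z_inverted_divide:
  assumes "s \<in> Z_inverted n"
  shows "s / of_nat n \<in> Z_inverted n"
proof -
  have "1 / of_nat n \<in> Z_inverted n"
    unfolding Z_inverted_iff by (rule exI[of _ 1], rule exI[of _ 1]) simp
  from Z_inverted_mult[OF assms this] show ?thesis
    by simp
qed

text \<open>
  The breakpoints of a composition include preimages of breakpoints, so that closure of the group
  under composition rests on the invariance of \<open>Z_inverted n\<close>. Taking this invariance into the
  definition spares its derivation from the breakpoints and slopes, and it is evident for generators.
\<close>
definition F_adic :: "nat \<Rightarrow> (real \<Rightarrow> real) set" where
  "F_adic n = {f \<in> carrier (F_group n). \<forall>t\<in>{0..1}. f t \<in> Z_inverted n \<longleftrightarrow> t \<in> Z_inverted n}"

lemma carrier_F_groupI: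
  assumes "f \<in> Bij {0..1}" "continuous_on {0..1} f" "strict_mono_on {0..1} f" "piecewise_linear_F n f"
  shows "f \<in> carrier (F_group n)"
  using homeomorphism_compact[OF _ assms(2), of "{0..1}"] assms
  by (auto simp: F_group_simps Bij_def bij_betw_def)

lemma F_adicD:
  assumes "f \<in> F_adic n"
  shows "f \<in> carrier (F_group n)" "f \<in> Bij {0..1}" "continuous_on {0..1} f"
    "strict_mono_on {0..1} f" "piecewise_linear_F n f"
    "\<And>t. 0 \<le> t \<Longrightarrow> t \<le> 1 \<Longrightarrow> f t \<in> Z_inverted n \<longleftrightarrow> t \<in> Z_inverted n"
  using assms by (auto simp: F_adic_def F_group_simps homeomorphism_def)

lemma F_adic_range:
  assumes "f \<in> F_adic n" "t \<in> {0..1}"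
  shows "f t \<in> {0..1}"
  using F_adicD(2)[OF assms(1)] assms(2) by (auto simp: Bij_def bij_betw_def)

lemma F_adic_less_iff:
  assumes "f \<in> F_adic n" "s \<in> {0..1}" "t \<in> {0..1}"
  shows "f s < f t \<longleftrightarrow> s < t"
  using strict_mono_on_less[OF F_adicD(4)[OF assms(1)]] assms(2,3) by blast

lemma F_adic_le_iff:
  assumes "f \<in> F_adic n" "s \<in> {0..1}" "t \<in> {0..1}"
  shows "f s \<le> f t \<longleftrightarrow> s \<le> t"
  using F_adic_less_iff[OF assms(1,3,2)] by linarith

lemma F_adic_one:
  assumes "n > 0"
  shows "one (F_group n) \<in> F_adic n"
proof -
  have "piecewise_linear_F n (\<lambda>t\<in>{0..1}. t)"
    unfolding piecewise_linear_F_def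
    by (rule exI[of _ "{}"]) (auto intro!: exI[of _ "0::int"] exI[of _ "0::real"])
  moreover have "continuous_on {0..1} (\<lambda>t\<in>{0..1::real}. t)"
    using continuous_on_eq[OF continuous_on_id, of "{0..1}" "\<lambda>t\<in>{0..1::real}. t"] by simp
  ultimately show ?thesis
    unfolding F_adic_def using carrier_F_groupI[OF id_Bij] assms
    by (auto simp: F_group_simps(3) strict_mono_on_def)
qed

text \<open>
  A breakpoint of $f \circ g$ is a breakpoint of \<open>g\<close> or the preimage under \<open>g\<close> of a breakpoint of
  \<open>f\<close>; the latter lies in \<open>Z_inverted n\<close> because \<open>g\<close> reflects this set.
\<close>
lemma F_adic_compose:
  assumes f: "f \<in> F_adic n" and g: "g \<in> F_adic n" and n: "n > 0"
  shows "compose {0..1} f g \<in> F_adic n"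
proof -
  let ?h = "compose {0..1} f g"
  have h: "?h t = f (g t)" if "0 \<le> t" "t \<le> 1" for t
    using that by (simp add: compose_def)
  have rg: "0 \<le> g t \<and> g t \<le> 1" if "0 \<le> t" "t \<le> 1" for t
    using F_adic_range[OF g] that by auto
  obtain Bf where Bf: "finite Bf" "Bf \<subseteq> Z_inverted n"
      "\<And>a b. 0 \<le> a \<Longrightarrow> a < b \<Longrightarrow> b \<le> 1 \<Longrightarrow> {a<..<b} \<inter> Bf = {} \<Longrightarrow>
           \<exists>(k::int) c. \<forall>t\<in>{a..b}. f t = of_nat n powi k * t + c"
    using F_adicD(5)[OF f] unfolding piecewise_linear_F_def by blast
  obtain Bg where Bg: "finite Bg" "Bg \<subseteq> Z_inverted n"
      "\<And>a b. 0 \<le> a \<Longrightarrow> a < b \<Longrightarrow> b \<le> 1 \<Longrightarrow> {a<..<b} \<inter> Bg = {} \<Longrightarrow>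
           \<exists>(k::int) c. \<forall>t\<in>{a..b}. g t = of_nat n powi k * t + c"
    using F_adicD(5)[OF g] unfolding piecewise_linear_F_def by blast
  have "?h \<in> Bij {0..1}"
    using compose_Bij F_adicD(2) f g by blast
  moreover have "continuous_on {0..1} ?h"
  proof -
    have "continuous_on {0..1} (\<lambda>t. f (g t))"
      by (rule continuous_on_compose2[OF F_adicD(3)[OF f] F_adicD(3)[OF g]]) (use rg in auto)
    then show ?thesis
      by (rule continuous_on_eq) (simp add: h)
  qed
  moreover have "strict_mono_on {0..1} ?h"
    using F_adic_less_iff[OF f] F_adic_less_iff[OF g] rg by (simp add: strict_mono_on_def h)
  moreover have "piecewise_linear_F n ?h"
  proof -
    let ?B = "Bg \<union> {t \<in> {0..1}. g t \<in> Bf}"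
    have "inj_on g {0..1}"
      using F_adicD(2)[OF g] by (auto simp: Bij_def bij_betw_def)
    then have "finite {t \<in> {0..1}. g t \<in> Bf}"
      using finite_vimage_IntI[OF Bf(1), of g "{0..1}"] by (simp add: vimage_def Int_def conj_commute)
    moreover have "?B \<subseteq> Z_inverted n"
      using Bg(2) Bf(2) F_adicD(6)[OF g] by auto
    moreover have "\<exists>(k::int) c. \<forall>t\<in>{a..b}. ?h t = of_nat n powi k * t + c"
      if ab: "0 \<le> a" "a < b" "b \<le> 1" "{a<..<b} \<inter> ?B = {}" for a b
    proof -
      obtain k c where kc: "\<forall>t\<in>{a..b}. g t = of_nat n powi k * t + c"
        using Bg(3)[of a b] ab by auto
      have lt: "g a < g b"
        using F_adic_less_iff[OF g] ab by auto
      have "{g a<..<g b} \<inter> Bf = {}"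
      proof (rule ccontr)
        assume "{g a<..<g b} \<inter> Bf \<noteq> {}"
        then obtain s where s: "s \<in> Bf" "g a < s" "s < g b" by auto
        have "s \<in> g ` {a..b}"
        proof -
          have "\<exists>t\<ge>a. t \<le> b \<and> g t = s"
            by (rule IVT') (use s ab in \<open>auto intro: continuous_on_subset[OF F_adicD(3)[OF g]]\<close>)
          then show ?thesis by auto
        qed
        then obtain t where t: "t \<in> {a..b}" "g t = s" by auto
        then have "a < t" "t < b"
          using s F_adic_less_iff[OF g] ab by (auto simp: less_le)
        then show False
          using ab t s(1) by auto
      qed
      then obtain k' c' where kc': "\<forall>t\<in>{g a..g b}. f t = of_nat n powi k' * t + c'"
        using Bf(3)[of "g a" "g b"] lt rg ab by auto
      have "?h t = of_nat n powi (k' + k) * t + (of_nat n powi k' * c + c')" if "t \<in> {a..b}" for t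
      proof -
        have "g t \<in> {g a..g b}"
          using that F_adic_le_iff[OF g] ab by auto
        then have "?h t = of_nat n powi k' * (of_nat n powi k * t + c) + c'"
          using kc' kc that h[of t] ab by auto
        also have "\<dots> = of_nat n powi k' * of_nat n powi k * t + (of_nat n powi k' * c + c')"
          by (simp add: algebra_simps)
        also have "of_nat n powi k' * of_nat n powi k = (of_nat n :: real) powi (k' + k)"
          using n by (simp add: power_int_add)
        finally show ?thesis .
      qed
      then show ?thesis by blast
    qed
    ultimately show ?thesis
      unfolding piecewise_linear_F_def using Bg(1) by (intro exI[of _ ?B]) auto
  qed
  ultimately show ?thesis
    unfolding F_adic_def using carrier_F_groupI F_adicD(6)[OF f] F_adicD(6)[OF g] h rg by auto
qed

text \<open>
  Here the breakpoints are the images of the breakpoints of \<open>f\<close>, and the slopes are inverted.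
\<close>
lemma F_adic_inverse:
  assumes f: "f \<in> F_adic n" and n: "n > 0"
  shows "(\<lambda>t\<in>{0..1}. inv_into {0..1} f t) \<in> F_adic n" (is "?g \<in> _")
proof -
  have bij: "bij_betw f {0..1} {0..1}"
    using F_adicD(2)[OF f] by (auto simp: Bij_def)
  have gb: "?g \<in> Bij {0..1}"
    using restrict_inv_into_Bij F_adicD(2)[OF f] by blast
  have rg: "0 \<le> ?g t \<and> ?g t \<le> 1" if "0 \<le> t" "t \<le> 1" for t
    using gb that by (auto simp: Bij_def bij_betw_def)
  have fg: "f (?g t) = t" if "0 \<le> t" "t \<le> 1" for t
    using that bij by (simp add: f_inv_into_f bij_betw_def)
  have gf: "?g (f t) = t" if "0 \<le> t" "t \<le> 1" for t
    using that bij bij_betwE[OF bij] by (simp add: bij_betw_def)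
  obtain B where B: "finite B" "B \<subseteq> Z_inverted n"
      "\<And>a b. 0 \<le> a \<Longrightarrow> a < b \<Longrightarrow> b \<le> 1 \<Longrightarrow> {a<..<b} \<inter> B = {} \<Longrightarrow>
           \<exists>(k::int) c. \<forall>t\<in>{a..b}. f t = of_nat n powi k * t + c"
    using F_adicD(5)[OF f] unfolding piecewise_linear_F_def by blast
  have sm: "strict_mono_on {0..1} ?g"
  proof (rule strict_mono_onI)
    fix s t :: real assume st: "s \<in> {0..1}" "t \<in> {0..1}" "s < t"
    then have "f (?g s) < f (?g t)"
      using fg by auto
    then show "?g s < ?g t"
      using F_adic_less_iff[OF f, of "?g s" "?g t"] rg[of s] rg[of t] st by auto
  qed
  have "continuous_on {0..1} ?g"
  proof -
    obtain g where g: "homeomorphism {0..1} {0..1} f g"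
      using F_adicD(1)[OF f] by (auto simp: F_group_simps)
    have "g t = ?g t" if "t \<in> {0..1}" for t
    proof -
      have "g t \<in> {0..1}" "f (g t) = t"
        using g that by (auto simp: homeomorphism_def)
      then show ?thesis
        using gf[of "g t"] by (metis atLeastAtMost_iff)
    qed
    then show ?thesis
      using g continuous_on_eq[of "{0..1}" g ?g] by (auto simp: homeomorphism_def)
  qed
  moreover have "piecewise_linear_F n ?g"
  proof -
    let ?B = "f ` (B \<inter> {0..1})"
    have "?B \<subseteq> Z_inverted n"
      using B(2) F_adicD(6)[OF f] by auto
    moreover have "\<exists>(k::int) c. \<forall>t\<in>{a..b}. ?g t = of_nat n powi k * t + c"
      if ab: "0 \<le> a" "a < b" "b \<le> 1" "{a<..<b} \<inter> ?B = {}" for a b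
    proof -
      have lt: "?g a < ?g b"
        using strict_mono_onD[OF sm, of a b] ab by auto
      have "{?g a<..<?g b} \<inter> B = {}"
      proof (rule ccontr)
        assume "{?g a<..<?g b} \<inter> B \<noteq> {}"
        then obtain s where s: "s \<in> B" "?g a < s" "s < ?g b" by auto
        moreover have s01: "s \<in> {0..1}"
          using s rg[of a] rg[of b] ab by auto
        moreover have "f (?g a) < f s" "f s < f (?g b)"
          using F_adic_less_iff[OF f] s s01 rg[of a] rg[of b] ab by auto
        ultimately have "f s \<in> {a<..<b} \<inter> ?B"
          using fg ab by auto
        then show False using ab by blast
      qed
      then obtain k c where kc: "\<forall>t\<in>{?g a..?g b}. f t = of_nat n powi k * t + c"
        using B(3)[of "?g a" "?g b"] lt rg[of a] rg[of b] ab by auto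
      have "?g t = of_nat n powi (-k) * t + (- (of_nat n powi (-k) * c))" if "t \<in> {a..b}" for t
      proof -
        have "?g t \<in> {?g a..?g b}"
          using strict_mono_on_leD[OF sm] that ab by auto
        then have "t = of_nat n powi k * ?g t + c"
          using kc fg[of t] that ab by auto
        then have "of_nat n powi (-k) * t - of_nat n powi (-k) * c
            = of_nat n powi (-k) * of_nat n powi k * ?g t"
          by (metis add_diff_cancel_right' mult.assoc right_diff_distrib)
        also have "\<dots> = ?g t"
          using n by (simp add: power_int_minus)
        finally show ?thesis by simp
      qed
      then show ?thesis by blast
    qed
    ultimately show ?thesis
      unfolding piecewise_linear_F_def using B(1) by (intro exI[of _ ?B]) auto
  qed
  moreover have "?g t \<in> Z_inverted n \<longleftrightarrow> t \<in> Z_inverted n" if "t \<in> {0..1}" for t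
    using F_adicD(6)[OF f, of "?g t"] rg[of t] fg[of t] that by auto
  ultimately show ?thesis
    unfolding F_adic_def using carrier_F_groupI[OF gb _ sm] by blast
qed

lemma F_group_mult:
  assumes "f \<in> F_adic n" "g \<in> F_adic n"
  shows "mult (F_group n) f g = compose {0..1} f g"
  using F_adicD(2) assms by (simp add: F_group_simps(2))

lemma F_adic_mult:
  assumes "f \<in> F_adic n" "g \<in> F_adic n" "n > 0"
  shows "mult (F_group n) f g \<in> F_adic n"
  using F_adic_compose F_group_mult assms by metis

text \<open>
  The inverse \<open>m_inv\<close> is defined by a description that ranges over the carrier of \<open>F_group n\<close>; it denotes
  the inverse function because the latter lies in this carrier.
\<close>
lemma F_group_inverse:
  assumes f: "f \<in> F_adic n" and n: "n > 0"
  shows "m_inv (F_group n) f = (\<lambda>t\<in>{0..1}. inv_into {0..1} f t)" (is "_ = ?g")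
proof -
  have g: "?g \<in> F_adic n"
    using F_adic_inverse[OF f n] .
  have bij: "bij_betw f {0..1} {0..1}"
    using F_adicD(2)[OF f] by (auto simp: Bij_def)
  have fg: "f (?g t) = t" if "t \<in> {0..1}" for t
    using that bij by (simp add: f_inv_into_f bij_betw_def)
  show ?thesis
    unfolding m_inv_def
  proof (rule the_equality)
    have "mult (F_group n) f ?g = one (F_group n)"
      unfolding F_group_mult[OF f g] F_group_simps(3) compose_def using fg by (auto intro: restrict_ext)
    moreover have "mult (F_group n) ?g f = one (F_group n)"
      unfolding F_group_mult[OF g f] F_group_simps(3)
      using Bij_compose_restrict_eq[OF F_adicD(2)[OF f]] .
    ultimately show "?g \<in> carrier (F_group n) \<and>
        mult (F_group n) f ?g = one (F_group n) \<and> mult (F_group n) ?g f = one (F_group n)"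
      using F_adicD(1)[OF g] by blast
  next
    fix y assume y: "y \<in> carrier (F_group n) \<and>
        mult (F_group n) f y = one (F_group n) \<and> mult (F_group n) y f = one (F_group n)"
    then have yb: "y \<in> Bij {0..1}"
      by (auto simp: F_group_simps(1))
    then have "compose {0..1} y f = (\<lambda>t\<in>{0..1}. t)"
      using y F_adicD(2)[OF f] by (simp add: F_group_simps)
    then have yf: "y (f t) = t" if "t \<in> {0..1}" for t
      using that by (metis compose_eq restrict_apply')
    show "y = ?g"
    proof (rule extensionalityI[of _ "{0..1}"])
      show "y \<in> extensional {0..1}" using yb Bij_imp_extensional by blast
      fix t :: real assume t: "t \<in> {0..1}"
      then show "y t = ?g t"
        using yf[of "?g t"] fg[OF t] F_adic_range[OF g t] by simp
    qed simp
  qed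
qed

lemma F_group_inverse_apply:
  assumes f: "f \<in> F_adic n" and n: "n > 0" and t: "t \<in> {0..1}"
  shows "f (m_inv (F_group n) f t) = t" "m_inv (F_group n) f (f t) = t"
proof -
  have bij: "bij_betw f {0..1} {0..1}"
    using F_adicD(2)[OF f] by (auto simp: Bij_def)
  show "f (m_inv (F_group n) f t) = t" "m_inv (F_group n) f (f t) = t"
    using bij t bij_betwE[OF bij] by (simp_all add: F_group_inverse[OF f n] bij_betw_def f_inv_into_f)
qed

lemma F_adic_m_inv:
  assumes "f \<in> F_adic n" "n > 0"
  shows "m_inv (F_group n) f \<in> F_adic n"
  using F_adic_inverse F_group_inverse assms by metis

text \<open>
  As the product is $fg = f \circ g$, the last letter of a word acts first: the orbit of a point is
  read off by cutting suffixes from the word.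
\<close>
abbreviation run :: "(real \<Rightarrow> real) list \<Rightarrow> real \<Rightarrow> real" where
  "run w \<equiv> foldr (\<lambda>a. a) w"

lemma run_in_unit:
  assumes "w \<in> lists (F_adic n)" "t \<in> {0..1}"
  shows "run w t \<in> {0..1}"
  using assms by (induction w) (auto dest: F_adic_range)

lemma run_less_iff:
  assumes "w \<in> lists (F_adic n)" "s \<in> {0..1}" "t \<in> {0..1}"
  shows "run w s < run w t \<longleftrightarrow> s < t"
  using assms(1)
proof (induction w)
  case (Cons a w)
  then show ?case
    using F_adic_less_iff[of a n "run w s" "run w t"] run_in_unit[of w n] assms(2,3) by simp
qed simp

lemma word_value_F_group:
  assumes "w \<in> lists (F_adic n)" "n > 0"
  shows "word_value (F_group n) w \<in> F_adic n \<and> (\<forall>t\<in>{0..1}. word_value (F_group n) w t = run w t)"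
  using assms(1)
proof (induction w)
  case Nil
  then show ?case
    using F_adic_one[OF assms(2)] by (simp add: word_value_def) (simp add: F_group_simps(3))
next
  case (Cons a w)
  then have a: "a \<in> F_adic n" and w: "word_value (F_group n) w \<in> F_adic n"
    and eq: "\<forall>t\<in>{0..1}. word_value (F_group n) w t = run w t"
    by auto
  have "word_value (F_group n) (a # w) = mult (F_group n) a (word_value (F_group n) w)"
    by (simp add: word_value_def)
  moreover have "compose {0..1} a (word_value (F_group n) w) t = a (run w t)" if "t \<in> {0..1}" for t
    using eq that by (simp add: compose_eq)
  ultimately show ?case
    using F_adic_mult[OF a w assms(2)] F_group_mult[OF a w] by simp
qed

lemma word_value_eq_iff:
  assumes "v \<in> lists (F_adic n)" "w \<in> lists (F_adic n)" "n > 0"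
  shows "word_value (F_group n) v = word_value (F_group n) w \<longleftrightarrow> (\<forall>t\<in>{0..1}. run v t = run w t)"
proof
  assume "\<forall>t\<in>{0..1}. run v t = run w t"
  then show "word_value (F_group n) v = word_value (F_group n) w"
    using word_value_F_group assms
    by (intro extensionalityI[of _ "{0..1}"] Bij_imp_extensional F_adicD(2)) auto
qed (use word_value_F_group assms in metis)

section \<open>The generators as piecewise affine maps\<close>

text \<open>
  A map $t \mapsto n^k t + c$ with $c \in \mathbb{Z}[1/n]$ preserves and reflects \<open>Z_inverted n\<close>.
\<close>
definition adic_affine_on :: "nat \<Rightarrow> (real \<Rightarrow> real) \<Rightarrow> real \<Rightarrow> real \<Rightarrow> bool" where
  "adic_affine_on n f a b \<longleftrightarrow>
     (\<exists>(k::int) c. c \<in> Z_inverted n \<and> (\<forall>t\<in>{a..b}. f t = of_nat n powi k * t + c))"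

lemma Z_inverted_powi: "of_nat n powi k \<in> Z_inverted n"
proof (cases "k \<ge> 0")
  case True
  have "of_int (int n ^ nat k) \<in> Z_inverted n"
    by (rule Z_inverted_of_int)
  with True show ?thesis
    by (simp add: power_int_def)
next
  case False
  have "(1::real) / of_nat n ^ nat (- k) \<in> Z_inverted n"
    unfolding Z_inverted_iff by (rule exI[of _ 1], rule exI[of _ "nat (- k)"]) simp
  with False show ?thesis
    by (simp add: power_int_def field_simps)
qed

lemma Z_inverted_affine_iff:
  assumes "c \<in> Z_inverted n" "n > 0"
  shows "of_nat n powi k * t + c \<in> Z_inverted n \<longleftrightarrow> t \<in> Z_inverted n"
proof
  assume "of_nat n powi k * t + c \<in> Z_inverted n"
  then have *: "of_nat n powi (- k) * (of_nat n powi k * t + c - c) \<in> Z_inverted n"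
    by (intro Z_inverted_mult Z_inverted_powi Z_inverted_diff assms)
  have "of_nat n powi (- k) * of_nat n powi k = (1::real)"
    using assms(2) by (simp add: power_int_minus)
  then have "of_nat n powi (- k) * (of_nat n powi k * t + c - c) = t"
    by (simp add: mult.assoc[symmetric])
  with * show "t \<in> Z_inverted n"
    by (simp only:)
qed (use assms Z_inverted_add Z_inverted_mult Z_inverted_powi in metis)

lemma adic_affine_onD:
  assumes "adic_affine_on n f a b" "n > 0"
  shows "continuous_on {a..b} f" "strict_mono_on {a..b} f"
    "\<And>t. t \<in> {a..b} \<Longrightarrow> f t \<in> Z_inverted n \<longleftrightarrow> t \<in> Z_inverted n"
proof -
  obtain k c where kc: "c \<in> Z_inverted n" "\<forall>t\<in>{a..b}. f t = of_nat n powi k * t + c"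
    using assms(1) unfolding adic_affine_on_def by blast
  have "continuous_on {a..b} (\<lambda>t. of_nat n powi k * t + c)"
    by (intro continuous_intros)
  then show "continuous_on {a..b} f"
    by (rule continuous_on_eq) (use kc in auto)
  show "strict_mono_on {a..b} f"
    using kc assms(2) by (auto simp: strict_mono_on_def)
  show "f t \<in> Z_inverted n \<longleftrightarrow> t \<in> Z_inverted n" if "t \<in> {a..b}" for t
    using kc that Z_inverted_affine_iff[OF kc(1) assms(2)] by auto
qed

lemma strict_mono_on_join:
  fixes f :: "real \<Rightarrow> real"
  assumes "strict_mono_on {a..b} f" "strict_mono_on {b..c} f"
  shows "strict_mono_on {a..c} f"
proof (rule strict_mono_onI)
  fix s t assume st: "s \<in> {a..c}" "t \<in> {a..c}" "s < t"
  consider "t \<le> b" | "b \<le> s" | "s < b" "b < t"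
    by linarith
  then show "f s < f t"
  proof cases
    case 3
    then have "f s < f b" "f b < f t"
      using assms st by (auto simp: strict_mono_on_def)
    then show ?thesis by simp
  qed (use assms st in \<open>auto simp: strict_mono_on_def\<close>)
qed

lemma continuous_on_join:
  fixes f :: "real \<Rightarrow> real"
  assumes "continuous_on {a..b} f" "continuous_on {b..c} f" "a \<le> b" "b \<le> c"
  shows "continuous_on {a..c} f"
  using continuous_on_closed_Un[OF _ _ assms(1,2)] assms(3,4)
  by (simp add: ivl_disj_un_two_touch(4))

text \<open>
  Four pieces are enough for all generators. Pieces may be degenerate, as the first piece of $x_0$ is.
\<close>
lemma F_adicI:
  assumes ext: "f \<in> extensional {0..1}" and f01: "f 0 = 0" "f 1 = 1" and n: "n > 0"
    and ord: "0 \<le> a" "a \<le> b" "b \<le> c" "c \<le> 1" and Z: "{a, b, c} \<subseteq> Z_inverted n"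
    and aff: "adic_affine_on n f 0 a" "adic_affine_on n f a b"
      "adic_affine_on n f b c" "adic_affine_on n f c 1"
  shows "f \<in> F_adic n"
proof -
  have cont: "continuous_on {0..1} f"
    using aff[THEN adic_affine_onD(1)[OF _ n]] continuous_on_join ord
    by (meson order_trans)
  have mono: "strict_mono_on {0..1} f"
    using aff[THEN adic_affine_onD(2)[OF _ n]] strict_mono_on_join by blast
  have "f ` {0..1} = {0..1}"
  proof
    show "f ` {0..1} \<subseteq> {0..1}"
      using strict_mono_on_leD[OF mono, of 0] strict_mono_on_leD[OF mono, of _ 1] f01 by auto
    show "{0..1} \<subseteq> f ` {0..1}"
    proof
      fix s :: real assume "s \<in> {0..1}"
      then have "\<exists>t\<ge>0. t \<le> 1 \<and> f t = s"
        by (intro IVT') (use cont f01 in auto)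
      then show "s \<in> f ` {0..1}" by auto
    qed
  qed
  then have bij: "f \<in> Bij {0..1}"
    using ext strict_mono_on_imp_inj_on[OF mono] by (simp add: Bij_def bij_betw_def)
  have "piecewise_linear_F n f"
    unfolding piecewise_linear_F_def
  proof (intro exI[of _ "{a, b, c}"] conjI allI impI)
    fix s t :: real assume st: "0 \<le> s" "s < t" "t \<le> 1" "{s<..<t} \<inter> {a, b, c} = {}"
    then have "t \<le> a \<or> s \<ge> a" "t \<le> b \<or> s \<ge> b" "t \<le> c \<or> s \<ge> c"
      by auto
    then consider "{s..t} \<subseteq> {0..a}" | "{s..t} \<subseteq> {a..b}" | "{s..t} \<subseteq> {b..c}" | "{s..t} \<subseteq> {c..1}"
      using st by fastforce
    then show "\<exists>(k::int) c. \<forall>u\<in>{s..t}. f u = of_nat n powi k * u + c"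
      using aff unfolding adic_affine_on_def by cases (meson subsetD)+
  qed (use Z in auto)
  moreover have "f t \<in> Z_inverted n \<longleftrightarrow> t \<in> Z_inverted n" if "t \<in> {0..1}" for t
  proof -
    consider "t \<le> a" | "a \<le> t" "t \<le> b" | "b \<le> t" "t \<le> c" | "c \<le> t"
      by linarith
    then show ?thesis
      using aff[THEN adic_affine_onD(3)[OF _ n]] that by cases auto
  qed
  ultimately show ?thesis
    unfolding F_adic_def using carrier_F_groupI[OF bij cont mono] by blast
qed

text \<open>
  With $n = p + 1$, every generator $x_i$ has four affine pieces: the identity on $[0, b_1]$, slope $1/n$ on
  $[b_1, b_2]$, a translation on $[b_2, b_3]$ and $t \mapsto nt - p$ on $[b_3, 1]$. The second summand of $b_2$
  occurs for $i = p$, since $x_p$ is a copy of $x_0$ in the last of the $n$ intervals. The value of $b_3$ is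
  forced by continuity.
\<close>
definition bp1 :: "nat \<Rightarrow> nat \<Rightarrow> real" where
  "bp1 p i = real i / (real p + 1)"

definition bp2 :: "nat \<Rightarrow> nat \<Rightarrow> real" where
  "bp2 p i = real p / (real p + 1) + (if i < p then 0 else real p / (real p + 1)^2)"

definition bp3 :: "nat \<Rightarrow> nat \<Rightarrow> real" where
  "bp3 p i = 1 - (bp2 p i - bp1 p i) / (real p + 1)"

lemma bp_order:
  assumes "i \<le> p" "p \<ge> 1"
  shows "0 \<le> bp1 p i" "bp1 p i < bp2 p i" "bp2 p i < bp3 p i" "bp3 p i < 1"
proof -
  have N: "real p + 1 > 0" "real p \<ge> 1" using assms by auto
  show "0 \<le> bp1 p i" by (simp add: bp1_def)
  show lt: "bp1 p i < bp2 p i"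
  proof (cases "i < p")
    case True
    then show ?thesis by (simp add: bp1_def bp2_def divide_strict_right_mono)
  next
    case False
    then have "i = p" using assms by simp
    then show ?thesis using N by (simp add: bp1_def bp2_def)
  qed
  then show "bp3 p i < 1" by (simp add: bp3_def)
  define M where "M = real p + 1"
  have M: "M > 0" "real p = M - 1"
    by (auto simp: M_def)
  show "bp2 p i < bp3 p i"
  proof (cases "i < p")
    case True
    have "bp3 p i - bp2 p i = (real i + 1) / M^2"
      using True M(1) unfolding bp1_def bp2_def bp3_def M_def[symmetric] M(2)
      by (simp add: field_simps power2_eq_square)
    also have "\<dots> > 0"
      using M by simp
    finally show ?thesis by simp
  next
    case False
    then have "i = p" using assms by simp
    then have "bp3 p i - bp2 p i = 1 / M^3"
      using M(1) unfolding bp1_def bp2_def bp3_def M_def[symmetric] \<open>i = p\<close> M(2)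
      by (simp add: field_simps power2_eq_square power3_eq_cube)
    also have "\<dots> > 0"
      using M by simp
    finally show ?thesis by simp
  qed
qed

lemma interpolate_affine:
  fixes m :: real
  assumes "c = m * a + q" "d = m * b + q" "a < b"
  shows "c + (t - a) * (d - c) / (b - a) = m * t + q"
proof -
  have "(t - a) * (d - c) / (b - a) = m * (t - a)"
    using assms by (simp add: divide_simps) (simp add: algebra_simps)
  then show ?thesis
    using assms(1) by (simp add: algebra_simps)
qed

text \<open>
  The four pieces come from the four ways in which the $j$-th interval can lie in the two subdivisions:
  in front of both subdivided intervals ($j < i$), subdivided in the range only ($i \le j < p$),
  subdivided in both ($p \le j \le i + p$), subdivided in the domain only ($j > i + p$). On each group the
  interpolation is one and the same affine map.
\<close>
lemma caret_map_pieces: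
  assumes i: "i < p" and t: "0 \<le> t" "t \<le> 1"
  shows "t \<le> bp1 p i \<Longrightarrow> caret_map p i t = t"
    and "bp1 p i \<le> t \<Longrightarrow> t \<le> bp2 p i \<Longrightarrow>
           caret_map p i t = bp1 p i + (t - bp1 p i) / (real p + 1)"
    and "bp2 p i \<le> t \<Longrightarrow> t \<le> bp3 p i \<Longrightarrow>
           caret_map p i t = t - (bp2 p i - bp1 p i) * real p / (real p + 1)"
    and "bp3 p i \<le> t \<Longrightarrow> caret_map p i t = (real p + 1) * t - real p"
proof -
  define N where "N = real p + 1"
  have N: "N > 0" "real (p + 1) = N" "real p = N - 1" by (auto simp: N_def)
  define j where "j = (LEAST j. t \<le> subdivision p p (j + 1))"
  have sub: "subdivision p p m = (if m \<le> p then real m / N else (N - 1) / N + (real m - (N - 1)) / N^2)"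
    if "m \<le> 2 * p + 1" for m
    using that N by (simp add: subdivision_def of_nat_diff)
  have "subdivision p p (2 * p + 1) = (N - 1) / N + N / N^2"
    using i N sub[of "2 * p + 1"] by simp
  also have "\<dots> = 1"
    using N(1) by (simp add: field_simps power2_eq_square)
  finally have "t \<le> subdivision p p (2 * p + 1)"
    using t by simp
  then have le: "j \<le> 2 * p" and ub: "t \<le> subdivision p p (j + 1)"
    unfolding j_def by (auto intro: Least_le LeastI)
  have lb: "subdivision p p j \<le> t"
  proof (cases j)
    case 0
    then show ?thesis using t by (simp add: subdivision_def)
  next
    case (Suc m)
    then have "\<not> t \<le> subdivision p p (m + 1)"
      unfolding j_def by (intro not_less_Least) simp
    then show ?thesis using Suc by simp
  qed
  have val: "caret_map p i t = subdivision p i j + (t - subdivision p p j) *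
      (subdivision p i (j + 1) - subdivision p i j) / (subdivision p p (j + 1) - subdivision p p j)"
    using t by (simp add: caret_map_def Let_def j_def)
  have b: "bp1 p i = real i / N" "bp2 p i = (N - 1) / N" "bp3 p i = (N - 1) / N + (real i + 1) / N^2"
    using i N(1) unfolding bp1_def bp2_def bp3_def N_def[symmetric] N(3)
    by (simp_all add: field_simps power2_eq_square)
  have o: "bp1 p i < bp2 p i" "bp2 p i < bp3 p i"
    using bp_order[of i p] i by auto
  consider "j < i" | "i \<le> j" "j < p" | "p \<le> j" "j \<le> i + p" | "i + p < j"
    by linarith
  then have "(t \<le> bp1 p i \<and> caret_map p i t = t) \<or>
      (bp1 p i \<le> t \<and> t \<le> bp2 p i \<and> caret_map p i t = bp1 p i + (t - bp1 p i) / N) \<or>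
      (bp2 p i \<le> t \<and> t \<le> bp3 p i \<and> caret_map p i t = t - (bp2 p i - bp1 p i) * (N - 1) / N) \<or>
      (bp3 p i \<le> t \<and> caret_map p i t = N * t - (N - 1))"
  proof cases
    case 1
    have "caret_map p i t = 1 * t + 0"
      unfolding val by (rule interpolate_affine)
        (use 1 i N in \<open>auto simp: sub subdivision_def field_simps\<close>)
    moreover have "t \<le> bp1 p i"
    proof -
      have "t \<le> real (j + 1) / N"
        using ub sub[of "j + 1"] 1 i by simp
      also have "\<dots> \<le> real i / N"
        using 1 N by (intro divide_right_mono) auto
      finally show ?thesis by (simp add: b)
    qed
    ultimately show ?thesis by simp
  next
    case 2
    have "caret_map p i t = 1 / N * t + (real i / N - real i / N^2)"
      unfolding val by (rule interpolate_affine)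
        (use 2 i N in \<open>auto simp: sub subdivision_def field_simps power2_eq_square of_nat_diff\<close>)
    moreover have "t \<le> bp2 p i"
    proof -
      have "t \<le> real (j + 1) / N"
        using ub sub[of "j + 1"] 2 i by simp
      also have "\<dots> \<le> (N - 1) / N"
        using 2 N by (intro divide_right_mono) auto
      finally show ?thesis by (simp add: b)
    qed
    moreover have "bp1 p i \<le> t"
    proof -
      have "bp1 p i \<le> real j / N"
        unfolding b using 2 N by (intro divide_right_mono) auto
      also have "\<dots> \<le> t"
        using lb sub[of j] 2 by simp
      finally show ?thesis .
    qed
    ultimately show ?thesis using N by (simp add: b field_simps power2_eq_square)
  next
    case 3
    have j: "subdivision p p j = (N - 1) / N + (real j - (N - 1)) / N^2"
      using sub[of j] 3 le N by (cases "j = p") auto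
    have j1: "subdivision p p (j + 1) = (N - 1) / N + (real j + 1 - (N - 1)) / N^2"
      using sub[of "j + 1"] 3 le i N by simp
    have "caret_map p i t = 1 * t + (real i / N - (N - 1) / N + (N - 1 - real i) / N^2)"
      unfolding val by (rule interpolate_affine)
        (use 3 i N in \<open>auto simp: j j1 subdivision_def field_simps power2_eq_square of_nat_diff\<close>)
    moreover have "t \<le> bp3 p i"
    proof -
      have "t \<le> (N - 1) / N + (real j + 1 - (N - 1)) / N^2"
        using ub j1 by simp
      also have "\<dots> \<le> (N - 1) / N + (real i + 1) / N^2"
        using 3 N by (intro add_left_mono divide_right_mono) auto
      finally show ?thesis by (simp add: b)
    qed
    moreover have "bp2 p i \<le> t"
    proof -
      have "0 \<le> (real j - (N - 1)) / N^2"
        using 3 N by simp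
      then show ?thesis
        using lb unfolding b j by linarith
    qed
    ultimately show ?thesis using N by (simp add: b field_simps power2_eq_square)
  next
    case 4
    have j: "subdivision p p j = (N - 1) / N + (real j - (N - 1)) / N^2"
      using sub[of j] 4 le N i by simp
    have j1: "subdivision p p (j + 1) = (N - 1) / N + (real j + 1 - (N - 1)) / N^2"
      using sub[of "j + 1"] 4 le i N by simp
    have k: "subdivision p i j = (real j - (N - 1)) / N"
    proof (cases "j = i + p + 1")
      case True
      then have "subdivision p i j = real i / N + N / N^2"
        using N by (simp add: subdivision_def)
      then show ?thesis
        using True N(1,3) by (simp add: field_simps power2_eq_square)
    next
      case False
      then show ?thesis
        using 4 le N i by (simp add: subdivision_def of_nat_diff)
    qed
    have k1: "subdivision p i (j + 1) = (real j + 1 - (N - 1)) / N"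
      using 4 le N i by (auto simp: subdivision_def of_nat_diff)
    have "caret_map p i t = N * t + (- (N - 1))"
      unfolding val j j1 k k1 using N(1)
      by (intro interpolate_affine) (simp_all add: field_simps power2_eq_square)
    moreover have "bp3 p i \<le> t"
    proof -
      have "real i + 1 \<le> real j - (N - 1)"
        using 4 N by simp
      then have "(real i + 1) / N^2 \<le> (real j - (N - 1)) / N^2"
        using N by (intro divide_right_mono) auto
      then show ?thesis
        using lb unfolding b j by linarith
    qed
    ultimately show ?thesis by simp
  qed
  note cases = this
  have e1: "bp1 p i = bp1 p i + (bp1 p i - bp1 p i) / N" by simp
  have e2: "bp1 p i + (bp2 p i - bp1 p i) / N = bp2 p i - (bp2 p i - bp1 p i) * (N - 1) / N"
    using N by (simp add: field_simps)
  have e3: "bp3 p i - (bp2 p i - bp1 p i) * (N - 1) / N = N * bp3 p i - (N - 1)"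
    using N(1) unfolding bp3_def N_def[symmetric] by (simp add: field_simps)
  show "caret_map p i t = t" if "t \<le> bp1 p i"
    using cases that o by (cases "t = bp1 p i") auto
  show "caret_map p i t = bp1 p i + (t - bp1 p i) / (real p + 1)" if "bp1 p i \<le> t" "t \<le> bp2 p i"
    unfolding N_def[symmetric] using cases that o e2 by (cases "t = bp1 p i"; cases "t = bp2 p i") auto
  show "caret_map p i t = t - (bp2 p i - bp1 p i) * real p / (real p + 1)" if "bp2 p i \<le> t" "t \<le> bp3 p i"
    unfolding N_def[symmetric] N(3) using cases that o e2 e3
    by (cases "t = bp2 p i"; cases "t = bp3 p i") auto
  show "caret_map p i t = (real p + 1) * t - real p" if "bp3 p i \<le> t"
    unfolding N_def[symmetric] N(3) using cases that o e3 by (cases "t = bp3 p i") auto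
qed

lemma F_gen_pieces:
  assumes i: "i \<le> p" and p: "p \<ge> 1" and t: "0 \<le> t" "t \<le> 1"
  shows "t \<le> bp1 p i \<Longrightarrow> F_gen p i t = t"
    and "bp1 p i \<le> t \<Longrightarrow> t \<le> bp2 p i \<Longrightarrow> F_gen p i t = bp1 p i + (t - bp1 p i) / (real p + 1)"
    and "bp2 p i \<le> t \<Longrightarrow> t \<le> bp3 p i \<Longrightarrow>
           F_gen p i t = t - (bp2 p i - bp1 p i) * real p / (real p + 1)"
    and "bp3 p i \<le> t \<Longrightarrow> F_gen p i t = (real p + 1) * t - real p"
proof -
  define N where "N = real p + 1"
  have N: "N > 0" "real (p + 1) = N" "real p = N - 1" by (auto simp: N_def)
  \<comment> \<open>For $i = p$ the generator is $x_0$ in the coordinate $u$ of the last interval.\<close>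
  define u where "u = N * t - (N - 1)"
  have u: "t = (u + (N - 1)) / N" "u \<le> 1"
    using N t by (auto simp: u_def field_simps)
  have P: "F_gen p i t = (if u \<le> 0 then t else (N - 1 + caret_map p 0 u) / N)" if "i = p"
  proof -
    have "real (p + 1) * t - real p = u"
      using N by (simp add: u_def)
    moreover have "t \<le> real p / real (p + 1) \<longleftrightarrow> u \<le> 0"
      unfolding N(2,3) using N(1) by (simp add: u_def field_simps)
    ultimately show ?thesis
      using that t unfolding F_gen_def N(2,3) by simp
  qed
  have b: "bp1 p p = (N - 1) / N" "bp2 p p = (N - 1) / N + (N - 1) / N^2"
    "bp3 p p = 1 - (N - 1) / N^3"
    using N(1) unfolding bp1_def bp2_def bp3_def N_def[symmetric] N(3)
    by (simp_all add: power2_eq_square power3_eq_cube)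
  have b0: "bp1 p 0 = 0" "bp2 p 0 = (N - 1) / N" "bp3 p 0 = 1 - (N - 1) / N^2"
    using N(1) p unfolding bp1_def bp2_def bp3_def N_def[symmetric] N(3)
    by (simp_all add: power2_eq_square)
  have c: "t \<le> bp1 p p \<longleftrightarrow> u \<le> 0" "bp1 p p \<le> t \<longleftrightarrow> 0 \<le> u" "t \<le> bp2 p p \<longleftrightarrow> u \<le> bp2 p 0"
     "bp2 p p \<le> t \<longleftrightarrow> bp2 p 0 \<le> u" "t \<le> bp3 p p \<longleftrightarrow> u \<le> bp3 p 0" "bp3 p p \<le> t \<longleftrightarrow> bp3 p 0 \<le> u"
    using N(1) by (auto simp: b b0 u_def field_simps power2_eq_square power3_eq_cube)
  have p0: "0 < p" using p by simp
  note C = caret_map_pieces[OF p0 _ u(2)]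
  have o: "0 < bp2 p 0" "bp2 p 0 < bp3 p 0"
    using bp_order[of 0 p] p b0 by auto
  show "F_gen p i t = t" if "t \<le> bp1 p i"
  proof (cases "i = p")
    case True then show ?thesis using P c that by simp
  qed (use caret_map_pieces(1)[OF _ t] that i in \<open>simp add: F_gen_def\<close>)
  show "F_gen p i t = bp1 p i + (t - bp1 p i) / (real p + 1)" if "bp1 p i \<le> t" "t \<le> bp2 p i"
  proof (cases "i = p")
    case True
    show ?thesis
    proof (cases "u = 0")
      case True
      then show ?thesis using P \<open>i = p\<close> u b N by simp
    next
      case False
      then have "caret_map p 0 u = u / N"
        using C(2) that c True b0 by (simp add: N_def)
      with P True False that c have "F_gen p i t = (N - 1 + u / N) / N"
        by simp
      also have "\<dots> = bp1 p i + (t - bp1 p i) / (real p + 1)"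
        using N(1) unfolding True b N_def[symmetric] u_def by (simp add: field_simps power2_eq_square)
      finally show ?thesis .
    qed
  qed (use caret_map_pieces(2)[OF _ t] that i in \<open>simp add: F_gen_def\<close>)
  show "F_gen p i t = t - (bp2 p i - bp1 p i) * real p / (real p + 1)" if "bp2 p i \<le> t" "t \<le> bp3 p i"
  proof (cases "i = p")
    case True
    then have "caret_map p 0 u = u - (bp2 p 0 - bp1 p 0) * real p / (real p + 1)" "\<not> u \<le> 0"
      using C(3) that c o by simp_all
    with P True have "F_gen p i t = (N - 1 + (u - (bp2 p 0 - bp1 p 0) * real p / (real p + 1))) / N"
      by simp
    also have "\<dots> = t - (bp2 p i - bp1 p i) * real p / (real p + 1)"
      using N(1) unfolding True b b0 N_def[symmetric] N(3) u_def
      by (simp add: field_simps power2_eq_square)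
    finally show ?thesis .
  qed (use caret_map_pieces(3)[OF _ t] that i in \<open>simp add: F_gen_def\<close>)
  show "F_gen p i t = (real p + 1) * t - real p" if "bp3 p i \<le> t"
  proof (cases "i = p")
    case True
    then have "caret_map p 0 u = (real p + 1) * u - real p" "\<not> u \<le> 0"
      using C(4) that c o by simp_all
    with P True have "F_gen p i t = (N - 1 + ((real p + 1) * u - real p)) / N"
      by simp
    also have "\<dots> = (real p + 1) * t - real p"
      using N(1) unfolding N_def[symmetric] N(3) u_def
      by (simp add: field_simps)
    finally show ?thesis .
  qed (use caret_map_pieces(4)[OF _ t] that i in \<open>simp add: F_gen_def\<close>)
qed

lemma bp_adic:
  shows "bp1 p i \<in> Z_inverted (p + 1)" "bp2 p i \<in> Z_inverted (p + 1)" "bp3 p i \<in> Z_inverted (p + 1)"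
proof -
  have d: "s / (real p + 1) \<in> Z_inverted (p + 1)" if "s \<in> Z_inverted (p + 1)" for s
    using Z_inverted_divide[OF that] by (simp add: add.commute)
  have n: "real m \<in> Z_inverted (p + 1)" for m
    using Z_inverted_of_int[of "int m" "p + 1"] by simp
  show 1: "bp1 p i \<in> Z_inverted (p + 1)"
    unfolding bp1_def by (intro d n)
  have "real p / (real p + 1) + real (if i < p then 0 else p) / (real p + 1) / (real p + 1) \<in> Z_inverted (p + 1)"
    by (intro Z_inverted_add d n) simp
  then show 2: "bp2 p i \<in> Z_inverted (p + 1)"
    unfolding bp2_def by (simp add: power2_eq_square split: if_splits)
  show "bp3 p i \<in> Z_inverted (p + 1)"
    unfolding bp3_def using n[of 1] by (intro Z_inverted_diff d 1 2) simp_all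
qed

lemma F_gen_in_F_adic:
  assumes i: "i \<le> p" and p: "p \<ge> 1"
  shows "F_gen p i \<in> F_adic (p + 1)"
proof (rule F_adicI[where a = "bp1 p i" and b = "bp2 p i" and c = "bp3 p i"])
  note o = bp_order[OF assms]
  note F = F_gen_pieces[OF assms]
  have N: "real (p + 1) = real p + 1" "real p + 1 > 0" by simp_all
  have d: "s / (real p + 1) \<in> Z_inverted (p + 1)" if "s \<in> Z_inverted (p + 1)" for s
    using Z_inverted_divide[OF that] by (simp add: add.commute)
  have n: "real m \<in> Z_inverted (p + 1)" for m
    using Z_inverted_of_int[of "int m" "p + 1"] by simp
  show "F_gen p i \<in> extensional {0..1}"
    by (simp add: F_gen_def caret_map_def)
  show "F_gen p i 0 = 0" "F_gen p i 1 = 1"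
    using F(1)[of 0] F(4)[of 1] o by auto
  show "p + 1 > 0" by simp
  show "0 \<le> bp1 p i" "bp1 p i \<le> bp2 p i" "bp2 p i \<le> bp3 p i" "bp3 p i \<le> 1"
    using o by auto
  show "{bp1 p i, bp2 p i, bp3 p i} \<subseteq> Z_inverted (p + 1)"
    using bp_adic by auto
  show "adic_affine_on (p + 1) (F_gen p i) 0 (bp1 p i)"
    unfolding adic_affine_on_def using F(1) o n[of 0]
    by (intro exI[of _ 0]) auto
  show "adic_affine_on (p + 1) (F_gen p i) (bp1 p i) (bp2 p i)"
    unfolding adic_affine_on_def
  proof (intro exI[of _ "-1::int"] exI[of _ "bp1 p i - bp1 p i / (real p + 1)"] conjI ballI)
    show "bp1 p i - bp1 p i / (real p + 1) \<in> Z_inverted (p + 1)"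
      by (intro Z_inverted_diff d bp_adic) simp
    show "F_gen p i t = real (p + 1) powi -1 * t + (bp1 p i - bp1 p i / (real p + 1))"
      if "t \<in> {bp1 p i..bp2 p i}" for t
    proof -
      have "real (p + 1) powi -1 * t = t / (real p + 1)"
        by (simp add: power_int_minus divide_inverse add.commute mult.commute)
      then show ?thesis
        using F(2)[of t] that o by (simp add: diff_divide_distrib)
    qed
  qed
  show "adic_affine_on (p + 1) (F_gen p i) (bp2 p i) (bp3 p i)"
    unfolding adic_affine_on_def
  proof (intro exI[of _ "0::int"] exI[of _ "- ((bp2 p i - bp1 p i) * real p / (real p + 1))"] conjI ballI)
    have "0 - (bp2 p i - bp1 p i) * real p / (real p + 1) \<in> Z_inverted (p + 1)"
      using n[of 0] by (intro Z_inverted_mult Z_inverted_diff d n bp_adic) simp_all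
    then show "- ((bp2 p i - bp1 p i) * real p / (real p + 1)) \<in> Z_inverted (p + 1)"
      by simp
    show "F_gen p i t = real (p + 1) powi 0 * t + - ((bp2 p i - bp1 p i) * real p / (real p + 1))"
      if "t \<in> {bp2 p i..bp3 p i}" for t
      using F(3)[of t] that o by simp
  qed
  show "adic_affine_on (p + 1) (F_gen p i) (bp3 p i) 1"
    unfolding adic_affine_on_def
  proof (intro exI[of _ "1::int"] exI[of _ "- real p"] conjI ballI)
    show "- real p \<in> Z_inverted (p + 1)"
      using Z_inverted_of_int[of "- int p" "p + 1"] by simp
    show "F_gen p i t = real (p + 1) powi 1 * t + - real p" if "t \<in> {bp3 p i..1}" for t
      using F(4)[of t] that o by (simp add: algebra_simps)
  qed
qed

section \<open>The spine\<close>

text \<open>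
  The orbit of $1/n$ under $x_0$. The two formulas agree at $j = 0$.
\<close>
definition spine :: "nat \<Rightarrow> int \<Rightarrow> real" where
  "spine p j = (if j \<le> 0 then (real p + 1) powi (j - 1) else 1 - real p * (real p + 1) powi (- j - 1))"

lemma spine_nonneg: "j \<ge> 0 \<Longrightarrow> spine p j = 1 - real p * (real p + 1) powi (- j - 1)"
  by (cases "j = 0") (simp_all add: spine_def power_int_minus field_simps)

lemma spine_less_Suc:
  assumes "p \<ge> 1"
  shows "spine p j < spine p (j + 1)"
proof (cases "j < 0")
  case True
  then show ?thesis
    using power_int_strict_increasing[of "j - 1" j "real p + 1"] assms by (simp add: spine_def)
next
  case False
  then show ?thesis
    using power_int_strict_increasing[of "- j - 2" "- j - 1" "real p + 1"] assms
    by (simp add: spine_nonneg diff_diff_eq algebra_simps)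
qed

lemma spine_strict_mono:
  assumes "p \<ge> 1"
  shows "strict_mono (spine p)"
proof (rule strict_monoI)
  fix i j :: int assume "i < j"
  then show "spine p i < spine p j"
  proof (induction j rule: int_gr_induct)
    case base
    show ?case using spine_less_Suc[OF assms] .
  next
    case (step j)
    then show ?case using spine_less_Suc[OF assms, of j] by simp
  qed
qed

lemma spine_less_iff: "p \<ge> 1 \<Longrightarrow> spine p i < spine p j \<longleftrightarrow> i < j"
  using strict_mono_less[OF spine_strict_mono] .

lemma spine_le_iff: "p \<ge> 1 \<Longrightarrow> spine p i \<le> spine p j \<longleftrightarrow> i \<le> j"
  using strict_mono_less_eq[OF spine_strict_mono] .

lemma spine_eq_iff: "p \<ge> 1 \<Longrightarrow> spine p i = spine p j \<longleftrightarrow> i = j"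
  using strict_mono_eq[OF spine_strict_mono] .

lemma spine_in_unit:
  assumes "p \<ge> 1"
  shows "spine p j \<in> {0..1}"
proof -
  have "0 < spine p (min j 0)" by (simp add: spine_def)
  moreover have "spine p (max j 0) < 1" using assms by (simp add: spine_nonneg)
  moreover have "spine p (min j 0) \<le> spine p j" "spine p j \<le> spine p (max j 0)"
    using spine_le_iff[OF assms] by auto
  ultimately show ?thesis by auto
qed

text \<open>
  To the left of $z_0$ the generator $x_0$ divides by $n$, and from $z_1$ on it is $t \mapsto nt - p$, that is,
  it multiplies the distance from $1$ by $n$.
\<close>
lemma F_gen_0_spine:
  assumes p: "p \<ge> 1"
  shows "F_gen p 0 (spine p j) = spine p (j - 1)"
proof -
  define N where "N = real p + 1"
  have N: "N > 0" "real p = N - 1" by (auto simp: N_def)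
  have b: "bp1 p 0 = 0" "bp2 p 0 = (N - 1) / N" "bp3 p 0 = 1 - (N - 1) / N^2"
    using N(1) p unfolding bp1_def bp2_def bp3_def N_def[symmetric] N(2)
    by (simp_all add: power2_eq_square)
  note F = F_gen_pieces[of 0 p "spine p j", OF _ p]
  have r: "0 \<le> spine p j" "spine p j \<le> 1" using spine_in_unit[OF p] by auto
  have sp: "spine p j = (if j \<le> 0 then N powi (j - 1) else 1 - (N - 1) * N powi (- j - 1))" for j
    by (simp add: spine_def N_def)
  show ?thesis
  proof (cases "j \<le> 0")
    case True
    then have "spine p j \<le> spine p 0"
      using spine_le_iff[OF p] by simp
    also have "spine p 0 = 1 / N"
      by (simp add: sp power_int_minus divide_inverse)
    also have "\<dots> \<le> bp2 p 0"
      unfolding b using N p by (intro divide_right_mono) auto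
    finally have "F_gen p 0 (spine p j) = spine p j / N"
      using F(2) r b by (simp add: N_def)
    also have "\<dots> = N powi (j - 1 - 1)"
      using True N(1) power_int_diff[of N "j - 1" 1] by (simp add: sp)
    finally show ?thesis using True by (simp add: sp)
  next
    case False
    have "bp3 p 0 = spine p 1"
      unfolding b by (simp add: sp power_int_minus divide_inverse)
    also have "\<dots> \<le> spine p j"
      using False spine_le_iff[OF p] by simp
    finally have "F_gen p 0 (spine p j) = N * spine p j - (N - 1)"
      using F(4) r b by (simp add: N_def)
    also have "\<dots> = 1 - (N - 1) * (N * N powi (- j - 1))"
      using False by (simp add: sp algebra_simps)
    also have "N * N powi (- j - 1) = N powi (- (j - 1) - 1)"
      using N(1) power_int_add[of N 1 "- j - 1"] by simp
    finally show ?thesis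
      using False spine_nonneg[of "j - 1" p] unfolding N_def[symmetric] N(2) by simp
  qed
qed

lemma F_gen_fixes_low:
  assumes i: "1 \<le> i" "i \<le> p" and t: "0 \<le> t" "t \<le> spine p 0"
  shows "F_gen p i t = t"
proof -
  have "spine p 0 = 1 / (real p + 1)"
    by (simp add: spine_def power_int_minus field_simps)
  also have "\<dots> \<le> bp1 p i"
    unfolding bp1_def using i by (intro divide_right_mono) auto
  finally show ?thesis
    using F_gen_pieces(1)[of i p t] i t spine_in_unit[of p 0] by auto
qed

text \<open>
  In terms of the distances from $1$ the generators with $i < p$ (where $v = 1$, $d = p - i$) and the last
  generator (where $v = 2$, $d = p$) have the same form.
\<close>
lemma bp_forms:
  assumes i: "i \<le> p" and p: "p \<ge> 1"
  obtains v d :: nat where "v \<ge> 1" "1 \<le> d" "d \<le> p" "v = 1 \<or> v = 2 \<and> i = p \<and> d = p"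
    "bp1 p i = 1 - (real d + 1) / (real p + 1) ^ v" "bp2 p i = 1 - 1 / (real p + 1) ^ v"
    "bp3 p i = 1 - real d / (real p + 1) ^ (v + 1)"
proof (cases "i < p")
  case True
  have "real (p - i) = real p - real i"
    using True by simp
  moreover have "bp1 p i = 1 - (real p - real i + 1) / (real p + 1)" "bp2 p i = 1 - 1 / (real p + 1)"
    using True by (simp_all add: bp1_def bp2_def divide_simps)
  moreover have "bp3 p i = 1 - (real p - real i) / (real p + 1) ^ 2"
  proof -
    have "bp2 p i - bp1 p i = (real p - real i) / (real p + 1)"
      using True by (simp add: bp1_def bp2_def diff_divide_distrib)
    then show ?thesis
      unfolding bp3_def by (simp add: power2_eq_square)
  qed
  ultimately show ?thesis
    using that[of 1 "p - i"] True by (simp add: power2_eq_square)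
next
  case False
  have "i = p" using i False by simp
  have 1: "bp1 p p = 1 - (real p + 1) / (real p + 1) ^ 2"
    by (simp add: bp1_def divide_simps power2_eq_square)
  have 2: "bp2 p p = 1 - 1 / (real p + 1) ^ 2"
    by (simp add: bp2_def divide_simps power2_eq_square) (simp add: algebra_simps)
  have "bp2 p p - bp1 p p = real p / (real p + 1) ^ 2"
    by (simp add: bp1_def bp2_def)
  then have "bp3 p p = 1 - real p / (real p + 1) ^ (2 + 1)"
    unfolding bp3_def by (simp add: power2_eq_square power3_eq_cube)
  then show ?thesis
    using that[of 2 p] p \<open>i = p\<close> 1 2 by simp
qed

text \<open>
  Both maps are in their last piece $t \mapsto nt - p$ there; $z_2$ is the largest of all the points $b_3$.
\<close>
lemma F_gen_eq_high:
  assumes i: "1 \<le> i" "i \<le> p" and t: "spine p 2 \<le> t" "t \<le> 1"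
  shows "F_gen p i t = F_gen p 0 t"
proof -
  define N where "N = real p + 1"
  have N: "N > 0" "real p = N - 1" "N \<ge> 1" by (auto simp: N_def)
  have p: "p \<ge> 1" using i by simp
  have *: "bp3 p l \<le> spine p 2" if "l \<le> p" for l
  proof -
    obtain v d where v: "v \<ge> 1" "1 \<le> d" "d \<le> p" "v = 1 \<or> v = 2 \<and> l = p \<and> d = p"
      "bp3 p l = 1 - real d / (real p + 1) ^ (v + 1)"
      using bp_forms[OF \<open>l \<le> p\<close> p] by metis
    have s: "spine p 2 = 1 - real p / N ^ 3"
      unfolding spine_def N_def[symmetric] by (simp add: power_int_def divide_inverse power_inverse)
    show ?thesis
    proof (cases "v = 1")
      case True
      have "real p / N ^ 3 = (real p / N) / N ^ 2"
        by (simp add: power3_eq_cube power2_eq_square)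
      also have "\<dots> \<le> real d / N ^ 2"
      proof (intro divide_right_mono)
        have "N * 1 \<le> N * real d"
          using N v by (intro mult_left_mono) auto
        moreover have "real p \<le> N * 1"
          by (simp add: N_def)
        ultimately have "real p \<le> N * real d"
          by (rule order_trans[rotated])
        then show "real p / N \<le> real d"
          using N by (simp add: divide_le_eq mult.commute)
      qed (use N in simp)
      finally show ?thesis
        using v True s by (simp add: N_def power2_eq_square)
    next
      case False
      then have "bp3 p l = 1 - real p / N ^ 3"
        using v that False by (simp add: N_def)
      then show ?thesis using s by simp
    qed
  qed
  have "0 \<le> t" using t spine_in_unit[OF p, of 2] by simp
  then have "F_gen p l t = (real p + 1) * t - real p" if "l \<le> p" for l
    using F_gen_pieces(4)[OF that p, of t] *[OF that] t by linarith
  then show ?thesis using i by simp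
qed

section \<open>Pairs of points at the ends of one standard interval\<close>

text \<open>
  \<open>P\<close> is the left end of a standard $n$-adic interval $[P, P + n^{-w}]$ that touches neither \<open>0\<close> nor \<open>1\<close>, and
  \<open>E\<close> is the point that divides it in the ratio $p : 1$. The letters map such intervals affinely onto each
  other, with few exceptions. The condition on \<open>a\<close> is that \<open>P\<close> is in the same class as the points of the spine
  in $\mathbb{Z}[1/n] / p\,\mathbb{Z}[1/n] \cong \mathbb{Z}/p$. All letters preserve this class (as
  $n \equiv 1$ modulo $p$), and it leaves $P = z_0$ as the only exception.
\<close>
definition child_pair :: "nat \<Rightarrow> real \<Rightarrow> real \<Rightarrow> bool" where
  "child_pair p P E \<longleftrightarrow> (\<exists>(a::int) w. P = of_int a / (real p + 1) ^ w \<and> int p dvd a - 1 \<and>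
     0 < P \<and> P + 1 / (real p + 1) ^ w < 1 \<and> E = P + real p / (real p + 1) ^ (w + 1))"

text \<open>
  A map that is affine on the standard interval at \<open>P\<close>, with a power of $n$ as slope, maps it to a standard
  interval at \<open>f P\<close>. The image does not touch \<open>0\<close> or \<open>1\<close> since \<open>f\<close> is an increasing bijection.
\<close>
lemma child_pairI_affine:
  assumes f: "f \<in> F_adic (p + 1)"
    and P: "0 < P" "P + 1 / (real p + 1) ^ w < 1" "E = P + real p / (real p + 1) ^ (w + 1)"
    and aff: "\<And>t. P \<le> t \<Longrightarrow> t \<le> P + 1 / (real p + 1) ^ w \<Longrightarrow> f t = m * t + q"
    and m: "m * (real p + 1) ^ w' = (real p + 1) ^ w"
    and a': "(m * P + q) * (real p + 1) ^ w' = of_int a'" "int p dvd a' - 1"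
  shows "child_pair p (f P) (f E)"
proof -
  define N where "N = real p + 1"
  have N: "N > 0" "real p \<le> N" by (auto simp: N_def)
  note P = P[folded N_def] and aff = aff[folded N_def] and m = m[folded N_def] and a' = a'[folded N_def]
  have pos: "1 / N ^ w > 0" using N by simp
  have fP: "f P = of_int a' / N ^ w'"
    using aff[of P] a'(1) pos N by (simp add: field_simps)
  have "m / N ^ w = 1 / N ^ w'"
    using m N by (simp add: field_simps)
  moreover have "f (P + 1 / N ^ w) = f P + m / N ^ w"
    using aff[of P] aff[of "P + 1 / N ^ w"] pos by (simp add: algebra_simps)
  ultimately have top: "f (P + 1 / N ^ w) = f P + 1 / N ^ w'"
    by simp
  have "real p / N ^ (w + 1) = real p / N * (1 / N ^ w)"
    by simp
  also have "\<dots> \<le> 1 * (1 / N ^ w)"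
    using N by (intro mult_right_mono) (auto simp: field_simps)
  finally have "f E = m * E + q"
    using P(3) N by (intro aff) auto
  then have fE: "f E = f P + real p / N ^ (w' + 1)"
  proof -
    have "m / N ^ (w + 1) = 1 / N ^ (w' + 1)"
      using m N by (simp add: field_simps)
    then have "real p * (m / N ^ (w + 1)) = real p * (1 / N ^ (w' + 1))"
      by simp
    then have "m * (real p / N ^ (w + 1)) = real p / N ^ (w' + 1)"
      by (simp add: mult.commute)
    then show ?thesis
      using aff[of P] pos \<open>f E = m * E + q\<close> unfolding P(3) by (simp add: algebra_simps)
  qed
  have u: "0 \<in> {0..1::real}" "P \<in> {0..1}" "P + 1 / N ^ w \<in> {0..1}" "1 \<in> {0..1::real}"
  proof -
    have "P < 1"
      using P(2) pos by linarith
    then show "P \<in> {0..1}" "P + 1 / N ^ w \<in> {0..1}"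
      using P(1,2) pos \<open>P < 1\<close> by auto
  qed auto
  have "0 < f P"
    using F_adic_less_iff[OF f u(1,2)] F_adic_range[OF f u(1)] P by auto
  moreover have "f P + 1 / N ^ w' < 1"
    using F_adic_less_iff[OF f u(3,4)] F_adic_range[OF f u(4)] P top by auto
  ultimately show ?thesis
    unfolding child_pair_def N_def[symmetric] using fP fE a'(2) by auto
qed

text \<open>
  A standard interval does not cross a point that is a multiple of its length.
\<close>
lemma grid_step:
  fixes N :: real
  assumes "of_int a / N ^ w < b" "b * N ^ w \<in> \<int>" "N > 0"
  shows "of_int a / N ^ w + 1 / N ^ w \<le> b"
proof -
  obtain c where c: "b * N ^ w = of_int c"
    using assms(2) by (auto elim: Ints_cases)
  then have "of_int a < (of_int c :: real)"
    using assms(1,3) by (simp add: field_simps)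
  then have "a + 1 \<le> c"
    by simp
  then have "real_of_int (a + 1) \<le> of_int c"
    by (simp only: of_int_le_iff)
  then show ?thesis
    using c assms(3) by (simp add: field_simps)
qed

lemma Ints_one_minus:
  fixes p :: nat
  assumes "v \<le> w"
  shows "(1 - real d / (real p + 1) ^ v) * (real p + 1) ^ w \<in> \<int>"
proof -
  have "(real p + 1) ^ w = (real p + 1) ^ v * (real p + 1) ^ (w - v)"
    using assms by (simp flip: power_add)
  then have "(1 - real d / (real p + 1) ^ v) * (real p + 1) ^ w
      = (real p + 1) ^ w - real d * (real p + 1) ^ (w - v)"
    by (simp add: left_diff_distrib)
  also have "\<dots> = of_int ((int p + 1) ^ w - int d * (int p + 1) ^ (w - v))"
    by simp
  finally show ?thesis by (metis Ints_of_int)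
qed

text \<open>
  An interval of length $n^{-w}$ that starts within $n^{-v}$ of \<open>1\<close> and does not reach \<open>1\<close> has $w > v$.
\<close>
lemma power_shrink:
  assumes "1 - 1 / (real p + 1) ^ v \<le> P" "P + 1 / (real p + 1) ^ w < 1" 
  shows "v < w"
proof (rule ccontr)
  assume "\<not> v < w"
  then have "(real p + 1) ^ w \<le> (real p + 1) ^ v"
    by (intro power_increasing) auto
  then have "1 / (real p + 1) ^ v \<le> 1 / (real p + 1) ^ w"
    by (intro divide_left_mono) auto
  then show False using assms by simp
qed

lemma grid_in_piece:
  assumes i: "i \<le> p" and p: "p \<ge> 1" and w: "w \<ge> 1"
    and v: "v = 1 \<or> v = 2 \<and> i = p"
    and P: "bp1 p i \<le> P" "P + 1 / (real p + 1) ^ w < 1"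
  shows "v \<le> w"
proof (cases "v = 1")
  case False
  then have "i = p" "v = 2" using v by auto
  have "1 - 1 / (real p + 1) ^ 1 = bp1 p p"
    by (simp add: bp1_def divide_simps)
  then have "1 < w"
    using power_shrink[of p 1 P w] P \<open>i = p\<close> by simp
  then show ?thesis using \<open>v = 2\<close> by simp
qed (use w in simp)

text \<open>
  A standard interval with a breakpoint of $x_i$ in its interior would touch \<open>0\<close> or \<open>1\<close>. So the interval at
  \<open>P\<close> lies in one of the four pieces. Each piece adds a multiple of $p$ to the numerator.
\<close>
lemma child_pair_F_gen:
  assumes i: "i \<le> p" and p: "p \<ge> 1" and ch: "child_pair p P E"
  shows "child_pair p (F_gen p i P) (F_gen p i E)"
proof -
  define N where "N = real p + 1"
  have N: "N > 0" "N \<noteq> 0" by (auto simp: N_def)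
  have pN: "real p = N - 1" "real_of_int (int p + 1) = N" by (auto simp: N_def)
  obtain a w where P: "P = of_int a / N ^ w" "int p dvd a - 1" "0 < P" "P + 1 / N ^ w < 1"
      "E = P + real p / N ^ (w + 1)"
    using ch unfolding child_pair_def N_def by blast
  obtain v d where v: "v \<ge> 1" "v = 1 \<or> v = 2 \<and> i = p" and b: "bp1 p i = 1 - (real d + 1) / N ^ v"
      "bp2 p i = 1 - 1 / N ^ v" "bp3 p i = 1 - real d / N ^ (v + 1)"
    using bp_forms[OF i p] unfolding N_def by metis
  note I = child_pairI_affine[OF F_gen_in_F_adic[OF i p] P(3), folded N_def, OF P(4,5)]
  note F = F_gen_pieces[OF i p, folded N_def]
  note Z = Ints_one_minus[of _ w, where p = p, folded N_def]
  note o = bp_order[OF i p]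
  have w1: "w \<ge> 1"
    using power_shrink[of p 0 P w] P(3,4) unfolding N_def by simp
  have aP: "P * N ^ w = of_int a"
    using P(1) N by simp
  consider "P < bp1 p i" | "bp1 p i \<le> P" "P < bp2 p i" | "bp2 p i \<le> P" "P < bp3 p i" | "bp3 p i \<le> P"
    by linarith
  then show ?thesis
  proof cases
    case 1
    obtain u where u: "w = Suc u" using w1 by (cases w) auto
    have "bp1 p i * N ^ w = of_int (int i * (int p + 1) ^ u)"
      using u N by (simp add: bp1_def N_def)
    then have "P + 1 / N ^ w \<le> bp1 p i"
      using grid_step[of a N w "bp1 p i"] 1 P(1) N(1) by (metis Ints_of_int)
    then have "F_gen p i t = 1 * t + 0" if "P \<le> t" "t \<le> P + 1 / N ^ w" for t
      using F(1)[of t] P(3,4) o that by simp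
    from I[OF this, of w a] show ?thesis
      using aP P(2) by simp
  next
    case 2
    have vw: "v \<le> w"
      using grid_in_piece[OF i p w1 v(2) 2(1)] P(4) unfolding N_def by simp
    then have "P + 1 / N ^ w \<le> bp2 p i"
      using grid_step[of a N w "bp2 p i"] 2 P(1) N(1) Z[of v 1] b by simp
    then have *: "F_gen p i t = 1 / N * t + (bp1 p i - bp1 p i / N)"
      if "P \<le> t" "t \<le> P + 1 / N ^ w" for t
      using F(2)[of t] P(3,4) o that 2 by (simp add: diff_divide_distrib)
    obtain u where u: "w = v + u" using vw le_Suc_ex by blast
    have "(1 / N * P + (bp1 p i - bp1 p i / N)) * N ^ (w + 1)
        = P * N ^ w + (N - 1) * (bp1 p i * N ^ w)"
      using N by (simp add: algebra_simps)
    also have "bp1 p i * N ^ w = N ^ w - (real d + 1) * N ^ u"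
      unfolding b u using N by (simp add: left_diff_distrib power_add)
    also have "P * N ^ w + (N - 1) * (N ^ w - (real d + 1) * N ^ u)
        = of_int (a + int p * ((int p + 1) ^ w - (int d + 1) * (int p + 1) ^ u))"
      unfolding aP by (simp add: N_def)
    finally have eq: "(1 / N * P + (bp1 p i - bp1 p i / N)) * N ^ (w + 1)
        = of_int (a + int p * ((int p + 1) ^ w - (int d + 1) * (int p + 1) ^ u))" .
    have "int p dvd (a - 1) + int p * ((int p + 1) ^ w - (int d + 1) * (int p + 1) ^ u)"
      using P(2) by simp
    then show ?thesis
      by (intro I[OF * _ eq]) (use N in \<open>simp_all add: algebra_simps\<close>)
  next
    case 3
    have vw: "v < w"
      using power_shrink[of p v P w] 3 b P(4) unfolding N_def by simp
    then have "P + 1 / N ^ w \<le> bp3 p i"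
      using grid_step[of a N w "bp3 p i"] 3 P(1) N(1) Z[of "v + 1" d] b by simp
    then have *: "F_gen p i t = 1 * t + - (real d * real p / N ^ (v + 1))"
      if "P \<le> t" "t \<le> P + 1 / N ^ w" for t
      using F(3)[of t] P(3,4) o that 3 unfolding b by (simp add: add_divide_distrib)
    obtain u where u: "w = v + 1 + u" using vw by (metis Suc_eq_plus1 Suc_leI le_Suc_ex)
    have "(1 * P + - (real d * real p / N ^ (v + 1))) * N ^ w
        = P * N ^ w - real d * real p * (N ^ w / N ^ (v + 1))" (is "?lhs = _")
      by (simp add: algebra_simps)
    also have "N ^ w / N ^ (v + 1) = N ^ u"
      unfolding u using N by (simp add: power_add)
    also have "P * N ^ w - real d * real p * N ^ u = of_int (a - int p * (int d * (int p + 1) ^ u))"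
      unfolding aP by (simp add: N_def)
    finally have eq: "?lhs = real_of_int (a - int p * (int d * (int p + 1) ^ u))" .
    have "int p dvd (a - 1) - int p * (int d * (int p + 1) ^ u)"
      using P(2) by simp
    then show ?thesis
      by (intro I[OF * _ eq]) (use N u in \<open>simp_all add: algebra_simps\<close>)
  next
    case 4
    have *: "F_gen p i t = N * t + - real p" if "P \<le> t" "t \<le> P + 1 / N ^ w" for t
      using F(4)[of t] P(3,4) that 4 by simp
    obtain u where u: "w = Suc u" using w1 by (cases w) auto
    have "(N * P + - real p) * N ^ u = P * N ^ w - real p * N ^ u" (is "?lhs = _")
      using u by (simp add: algebra_simps)
    also have "\<dots> = of_int (a - int p * (int p + 1) ^ u)"
      unfolding aP by (simp add: N_def)
    finally have eq: "?lhs = real_of_int (a - int p * (int p + 1) ^ u)" .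
    have "int p dvd (a - 1) - int p * (int p + 1) ^ u"
      using P(2) by simp
    then show ?thesis
      by (intro I[OF * _ eq]) (use N u in \<open>simp_all add: algebra_simps\<close>)
  qed
qed

text \<open>
  The breakpoints of $x_i^{-1}$ are $b_1$, an interior point $c_2$ of the standard interval
  $[b_1, c_3] = [b_1, b_1 + n^{-v}]$, and $c_3$. So this interval is the only one without \<open>0\<close> and \<open>1\<close> that is
  broken by $x_i^{-1}$. Its left end is $b_1 = i/n$, which lies in the class of the spine only for $i = 1$, when
  it is $z_0$.
\<close>
lemma child_pair_inverse:
  assumes i: "i \<le> p" and p: "p \<ge> 1" and ch: "child_pair p P E" and ex: "i = 0 \<or> P \<noteq> spine p 0"
  defines "g \<equiv> m_inv (F_group (p + 1)) (F_gen p i)"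
  shows "child_pair p (g P) (g E)"
proof -
  define N where "N = real p + 1"
  have N: "N > 0" "N \<noteq> 0" by (auto simp: N_def)
  obtain a w where P: "P = of_int a / N ^ w" "int p dvd a - 1" "0 < P" "P + 1 / N ^ w < 1"
      "E = P + real p / N ^ (w + 1)"
    using ch unfolding child_pair_def N_def by blast
  obtain v d where v: "v \<ge> 1" "v = 1 \<or> v = 2 \<and> i = p" and d: "1 \<le> d" "d \<le> p"
      and b: "bp1 p i = 1 - (real d + 1) / N ^ v"
      "bp2 p i = 1 - 1 / N ^ v" "bp3 p i = 1 - real d / N ^ (v + 1)"
    using bp_forms[OF i p] unfolding N_def by metis
  have gen: "F_gen p i \<in> F_adic (p + 1)"
    using F_gen_in_F_adic[OF i p] .
  have inv: "g s = t" if "F_gen p i t = s" "0 \<le> t" "t \<le> 1" for s t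
    using F_group_inverse_apply(2)[OF gen, of t] that by (simp add: g_def)
  have gad: "g \<in> F_adic (p + 1)"
    unfolding g_def using F_adic_m_inv[OF gen] by simp
  note I = child_pairI_affine[OF gad P(3), folded N_def, OF P(4,5)]
  note F = F_gen_pieces[OF i p, folded N_def]
  note Z = Ints_one_minus[of _ w, where p = p, folded N_def]
  note o = bp_order[OF i p]
  have w1: "w \<ge> 1"
    using power_shrink[of p 0 P w] P(3,4) unfolding N_def by simp
  have aP: "P * N ^ w = of_int a"
    using P(1) N by simp
  \<comment> \<open>These are the images of \<open>bp2 p i\<close> and \<open>bp3 p i\<close>; the point \<open>bp1 p i\<close> is fixed.\<close>
  define c2 where "c2 = bp1 p i + real d / N ^ (v + 1)"
  define c3 where "c3 = 1 - real d / N ^ v"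
  have e1: "bp2 p i - bp1 p i = real d / N ^ v"
    unfolding b by (simp add: add_divide_distrib)
  have G1: "g s = s" if "0 \<le> s" "s \<le> bp1 p i" for s
    using that F(1)[of s] o by (intro inv) auto
  have G2: "g s = N * s + - (real p * bp1 p i)" if "bp1 p i \<le> s" "s \<le> c2" for s
  proof -
    define t where "t = bp1 p i + N * (s - bp1 p i)"
    have "bp1 p i \<le> t"
      using that N by (simp add: t_def)
    moreover have "t \<le> bp2 p i"
    proof -
      have "N * (s - bp1 p i) \<le> N * (real d / N ^ (v + 1))"
        using that N unfolding c2_def by (intro mult_left_mono) auto
      also have "\<dots> = bp2 p i - bp1 p i"
        using N e1 by simp
      finally show ?thesis by (simp add: t_def)
    qed
    ultimately have "F_gen p i t = s"
      using F(2)[of t] o N by (simp add: t_def)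
    then have "g s = t"
      using \<open>bp1 p i \<le> t\<close> \<open>t \<le> bp2 p i\<close> o by (intro inv) auto
    then show ?thesis
      by (simp add: t_def N_def algebra_simps)
  qed
  have G3: "g s = 1 * s + real d * real p / N ^ (v + 1)" if "c2 \<le> s" "s \<le> c3" for s
  proof -
    define t where "t = s + real d * real p / N ^ (v + 1)"
    have e2: "real d * real p / N ^ (v + 1) = real d / N ^ v - real d / N ^ (v + 1)"
      by (simp add: N_def divide_simps) (simp add: algebra_simps)
    have "bp2 p i \<le> t" "t \<le> bp3 p i"
      using that e1 unfolding t_def e2 c2_def c3_def b by auto
    then have "F_gen p i t = s"
      using F(3)[of t] o e1 by (simp add: t_def)
    then have "g s = t"
      using \<open>bp2 p i \<le> t\<close> \<open>t \<le> bp3 p i\<close> o by (intro inv) auto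
    then show ?thesis
      by (simp add: t_def)
  qed
  have G4: "g s = 1 / N * s + real p / N" if "c3 \<le> s" "s \<le> 1" for s
  proof -
    define t where "t = (s + real p) / N"
    have "bp3 p i \<le> t"
    proof -
      have "bp3 p i = (c3 + real p) / N"
      proof -
        have "c3 + real p = N - real d / N ^ v"
          by (simp add: c3_def N_def)
        then show ?thesis
          unfolding b using N by (simp add: diff_divide_distrib mult.commute)
      qed
      also have "\<dots> \<le> t"
        using that N unfolding t_def by (intro divide_right_mono) auto
      finally show ?thesis .
    qed
    moreover have "t \<le> 1"
      using that N by (simp add: t_def N_def)
    ultimately have "F_gen p i t = s"
      using F(4)[of t] o N by (simp add: t_def)
    then have "g s = t"
      using \<open>bp3 p i \<le> t\<close> \<open>t \<le> 1\<close> o by (intro inv) auto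
    then show ?thesis
      by (simp add: t_def add_divide_distrib)
  qed
  \<comment> \<open>The interval at \<open>P\<close> is strictly contained in the interval \<open>[bp1 p i, c3]\<close> of length $n^{-v}$.\<close>
  have vw: "v < w" if "bp1 p i \<le> P" "P < c3"
  proof (rule ccontr)
    assume "\<not> v < w"
    moreover have "v \<le> w"
      using grid_in_piece[OF i p w1 v(2) that(1)] P(4) unfolding N_def by simp
    ultimately have w: "w = v" by simp
    have "P = bp1 p i"
    proof (rule ccontr)
      assume "P \<noteq> bp1 p i"
      then have "bp1 p i < P" using that by simp
      moreover have "bp1 p i = of_int ((int p + 1) ^ w - (int d + 1)) / N ^ w"
        unfolding b w using N by (simp add: N_def[symmetric] diff_divide_distrib)
      ultimately have "bp1 p i + 1 / N ^ w \<le> P"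
        using grid_step[of _ N w P] aP N(1) by (metis Ints_of_int)
      moreover have "bp1 p i + 1 / N ^ w = c3"
        unfolding b w c3_def by (simp add: add_divide_distrib)
      ultimately show False using that by simp
    qed
    then have "of_int a = real i * N ^ (v - 1)"
    proof -
      obtain u where u: "v = Suc u" using v(1) by (cases v) auto
      have "of_int a = real i / N * N ^ w"
        using aP \<open>P = bp1 p i\<close> by (simp add: bp1_def N_def)
      then show ?thesis
        using u w N by simp
    qed
    then have "real_of_int a = real_of_int (int i * (int p + 1) ^ (v - 1))"
      by (simp add: N_def)
    then have "a = int i * (int p + 1) ^ (v - 1)"
      by (simp only: of_int_eq_iff)
    then have "a = int i \<or> a = int i + int p * int i"
      using v(2) by (auto simp: algebra_simps)
    then obtain c where "int i - 1 = (a - 1) - int p * c"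
      by (metis add_diff_cancel_left' diff_add_eq diff_zero mult_zero_right add.commute)
    then have "int p dvd int i - 1"
      using P(2) by (metis dvd_diff dvd_triv_left)
    moreover have "i \<ge> 1"
      using \<open>P = bp1 p i\<close> P(3) by (cases i) (auto simp: bp1_def)
    ultimately have "i = 1"
      using i zdvd_imp_le[of "int p" "int i - 1"] by (cases "i = 1") auto
    then have "P = spine p 0"
      using \<open>P = bp1 p i\<close> by (simp add: bp1_def spine_def power_int_minus divide_inverse)
    then show False using ex \<open>i = 1\<close> by simp
  qed
  consider "P < bp1 p i" | "bp1 p i \<le> P" "P < c2" | "c2 \<le> P" "P < c3" | "c3 \<le> P"
    by linarith
  then show ?thesis
  proof cases
    case 1
    obtain u where u: "w = Suc u" using w1 by (cases w) auto
    have "bp1 p i * N ^ w = of_int (int i * (int p + 1) ^ u)"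
      using u N by (simp add: bp1_def N_def)
    then have "P + 1 / N ^ w \<le> bp1 p i"
      using grid_step[of a N w "bp1 p i"] 1 P(1) N(1) by (metis Ints_of_int)
    then have "g t = 1 * t + 0" if "P \<le> t" "t \<le> P + 1 / N ^ w" for t
      using G1[of t] P(3) that by simp
    from I[OF this, of w a] show ?thesis
      using aP P(2) by simp
  next
    case 2
    have "c2 \<le> c3"
    proof -
      have "real d / N ^ (v + 1) \<le> 1 / N ^ v"
      proof -
        have "real d / N ^ (v + 1) = real d / N * (1 / N ^ v)"
          by simp
        also have "\<dots> \<le> 1 * (1 / N ^ v)"
          using d N by (intro mult_right_mono) (auto simp: N_def)
        finally show ?thesis by simp
      qed
      then show ?thesis
        unfolding c2_def c3_def b by (simp add: add_divide_distrib)
    qed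
    then have "v < w" using vw 2 by simp
    then obtain u where u: "w = v + 1 + u" by (metis Suc_eq_plus1 Suc_leI le_Suc_ex)
    have b1: "bp1 p i * N ^ (v + u) = N ^ (v + u) - (real d + 1) * N ^ u"
      unfolding b using N by (simp add: left_diff_distrib power_add)
    have "c2 * N ^ w = N * (bp1 p i * N ^ (v + u)) + real d * N ^ u"
      unfolding c2_def u using N by (simp add: distrib_right power_add)
    also have "\<dots> = of_int ((int p + 1) * ((int p + 1) ^ (v + u) - (int d + 1) * (int p + 1) ^ u) + int d * (int p + 1) ^ u)"
      unfolding b1 by (simp add: N_def)
    finally have "P + 1 / N ^ w \<le> c2"
      using grid_step[of a N w c2] 2 P(1) N(1) by (metis Ints_of_int)
    then have *: "g t = N * t + - (real p * bp1 p i)" if "P \<le> t" "t \<le> P + 1 / N ^ w" for t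
      using G2[of t] that 2 by simp
    have "(N * P + - (real p * bp1 p i)) * N ^ (v + u) = P * N ^ w - real p * (bp1 p i * N ^ (v + u))" (is "?lhs = _")
      using u by (simp add: algebra_simps)
    also have "\<dots> = of_int (a - int p * ((int p + 1) ^ (v + u) - (int d + 1) * (int p + 1) ^ u))"
      unfolding aP b1 by (simp add: N_def)
    finally have eq: "?lhs = real_of_int (a - int p * ((int p + 1) ^ (v + u) - (int d + 1) * (int p + 1) ^ u))" .
    have "int p dvd (a - 1) - int p * ((int p + 1) ^ (v + u) - (int d + 1) * (int p + 1) ^ u)"
      using P(2) by simp
    then show ?thesis
      by (intro I[OF * _ eq]) (use N u in \<open>simp_all add: algebra_simps\<close>)
  next
    case 3
    have "bp1 p i \<le> c2"
      using N by (simp add: c2_def)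
    then have "v < w" using vw 3 by simp
    then obtain u where u: "w = v + 1 + u" by (metis Suc_eq_plus1 Suc_leI le_Suc_ex)
    have "P + 1 / N ^ w \<le> c3"
      using grid_step[of a N w c3] 3 P(1) N(1) Z[of v d] u by (simp add: c3_def)
    then have *: "g t = 1 * t + real d * real p / N ^ (v + 1)"
      if "P \<le> t" "t \<le> P + 1 / N ^ w" for t
      using G3[of t] that 3 by simp
    have "(1 * P + real d * real p / N ^ (v + 1)) * N ^ w
        = P * N ^ w + real d * real p * (N ^ w / N ^ (v + 1))" (is "?lhs = _")
      by (simp add: algebra_simps)
    also have "N ^ w / N ^ (v + 1) = N ^ u"
      unfolding u using N by (simp add: power_add)
    also have "P * N ^ w + real d * real p * N ^ u = of_int (a + int p * (int d * (int p + 1) ^ u))"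
      unfolding aP by (simp add: N_def)
    finally have eq: "?lhs = real_of_int (a + int p * (int d * (int p + 1) ^ u))" .
    have "int p dvd (a - 1) + int p * (int d * (int p + 1) ^ u)"
      using P(2) by simp
    then show ?thesis
      by (intro I[OF * _ eq]) (use N u in \<open>simp_all add: algebra_simps\<close>)
  next
    case 4
    have *: "g t = 1 / N * t + real p / N" if "P \<le> t" "t \<le> P + 1 / N ^ w" for t
      using G4[of t] that 4 P(4) by simp
    have "(1 / N * P + real p / N) * N ^ (w + 1) = P * N ^ w + real p * N ^ w" (is "?lhs = _")
      using N by (simp add: algebra_simps)
    also have "\<dots> = of_int (a + int p * (int p + 1) ^ w)"
      unfolding aP by (simp add: N_def)
    finally have eq: "?lhs = real_of_int (a + int p * (int p + 1) ^ w)" .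
    have "int p dvd (a - 1) + int p * (int p + 1) ^ w"
      using P(2) by simp
    then show ?thesis
      by (intro I[OF * _ eq]) (use N in \<open>simp_all add: algebra_simps\<close>)
  qed
qed

section \<open>Labels and the lower bound for the length of a word\<close>

definition inv_gen :: "nat \<Rightarrow> nat \<Rightarrow> real \<Rightarrow> real" where
  "inv_gen p i = m_inv (F_group (p + 1)) (F_gen p i)"

definition letters :: "nat \<Rightarrow> (real \<Rightarrow> real) set" where
  "letters p = sym_gens (F_group (p + 1)) (F_gens p)"

lemma letters_iff: "a \<in> letters p \<longleftrightarrow> (\<exists>i\<le>p. a = F_gen p i \<or> a = inv_gen p i)"
  by (auto simp: letters_def inv_gen_def sym_gens_def F_gens_def)

text \<open>
  The right half of the spine has the label between the two others: a letter moves a point from the left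
  half of the spine to the right half or off the spine from the right half, or conversely, but never
  directly between the left half and the complement of the spine.
\<close>
definition label :: "nat \<Rightarrow> real \<Rightarrow> int" where
  "label p t = (if t \<in> spine p ` {..0} then 0 else if t \<in> spine p ` {1..} then 1 else 2)"

fun variation :: "nat \<Rightarrow> (real \<Rightarrow> real) list \<Rightarrow> real \<Rightarrow> int" where
  "variation p [] t = 0"
| "variation p (a # w) t = \<bar>label p (a (run w t)) - label p (run w t)\<bar> + variation p w t"

lemma variation_append: "variation p (u @ v) t = variation p u (run v t) + variation p v t"
  by (induction u) auto

lemma variation_ge: "\<bar>label p (run w t) - label p t\<bar> \<le> variation p w t"
  by (induction w) auto

lemma sum_le_one_if_inj:
  assumes "finite T" "inj_on g T"
  shows "(\<Sum>t\<in>T. if g t = s then 1 else 0) \<le> (1::int)"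
proof -
  have "(\<Sum>t\<in>T. if g t = s then 1 else 0) = int (card {t \<in> T. g t = s})"
    using assms(1) by (simp add: sum.If_cases Int_def)
  also have "card {t \<in> T. g t = s} \<le> card {s}"
    by (rule card_inj_on_le[of g]) (use assms(2) in \<open>auto simp: inj_on_def\<close>)
  finally show ?thesis by simp
qed

locale thompson_group =
  fixes p :: nat
  assumes p: "p \<ge> 1"
begin

lemma gen_adic: "i \<le> p \<Longrightarrow> F_gen p i \<in> F_adic (p + 1)"
  using F_gen_in_F_adic p by simp

lemma inv_gen_adic: "i \<le> p \<Longrightarrow> inv_gen p i \<in> F_adic (p + 1)"
  unfolding inv_gen_def by (intro F_adic_m_inv gen_adic) simp_all

lemma letters_adic: "letters p \<subseteq> F_adic (p + 1)"
  using gen_adic inv_gen_adic by (auto simp: letters_iff)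

lemma word_adic: "w \<in> lists (letters p) \<Longrightarrow> w \<in> lists (F_adic (p + 1))"
  using letters_adic lists_mono by blast

lemma gen_inv_gen:
  assumes "i \<le> p" "t \<in> {0..1}"
  shows "F_gen p i (inv_gen p i t) = t" "inv_gen p i (F_gen p i t) = t"
  using F_group_inverse_apply[OF gen_adic[OF assms(1)] _ assms(2)] by (simp_all add: inv_gen_def)

lemma run_unit: "w \<in> lists (letters p) \<Longrightarrow> t \<in> {0..1} \<Longrightarrow> run w t \<in> {0..1}"
  using run_in_unit word_adic by blast

lemma run_less: "w \<in> lists (letters p) \<Longrightarrow> s \<in> {0..1} \<Longrightarrow> t \<in> {0..1} \<Longrightarrow> run w s < run w t \<longleftrightarrow> s < t"
  using run_less_iff word_adic by blast

lemma run_inj: "w \<in> lists (letters p) \<Longrightarrow> inj_on (run w) {0..1}"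
  using run_less[of w] by (intro inj_onI) (metis less_irrefl linorder_less_linear)

lemmas unit = spine_in_unit[OF p]
lemmas spine_iffs = spine_less_iff[OF p] spine_le_iff[OF p] spine_eq_iff[OF p]

lemma label_spine: "label p (spine p j) = (if j \<le> 0 then 0 else 1)"
  by (auto simp: label_def spine_iffs)

lemma label_between:
  assumes "spine p j < t" "t < spine p (j + 1)"
  shows "label p t = 2"
  using assms by (auto simp: label_def spine_iffs)

lemmas lab = label_spine label_between

lemma label_cases: "label p t \<in> {0, 1, 2}"
  by (simp add: label_def)

lemma label_0_le: "label p t = 0 \<Longrightarrow> t \<le> spine p 0"
  by (auto simp: label_def spine_iffs split: if_splits)

lemma label_1_ge: "label p t = 1 \<Longrightarrow> spine p 1 \<le> t"
  by (auto simp: label_def spine_iffs split: if_splits)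

lemma gen_spine:
  assumes "i \<le> p" "j \<noteq> 1"
  shows "F_gen p i (spine p j) = (if i \<ge> 1 \<and> j \<le> 0 then spine p j else spine p (j - 1))"
proof (cases "i = 0")
  case True
  then show ?thesis using F_gen_0_spine[OF p] by simp
next
  case False
  show ?thesis
  proof (cases "j \<le> 0")
    case True
    then show ?thesis
      using False assms F_gen_fixes_low[of i p "spine p j"] unit[of j] by (simp add: spine_iffs)
  next
    case j: False
    then show ?thesis
      using False assms F_gen_eq_high[of i p "spine p j"] unit[of j] F_gen_0_spine[OF p]
      by (simp add: spine_iffs)
  qed
qed

text \<open>
  A generator maps every point of the spine except $z_1$ to a point of the same half of the spine, and
  every point of the spine is the image of a point of the spine.
\<close>
lemma label_gen:
  assumes i: "i \<le> p" and t: "t \<in> {0..1}" "t \<noteq> spine p 1"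
  shows "label p (F_gen p i t) = label p t"
proof (cases "t \<in> range (spine p)")
  case True
  then obtain j where "t = spine p j" "j \<noteq> 1" using t by auto
  then show ?thesis using gen_spine[OF i] by (auto simp: label_spine)
next
  case False
  have "F_gen p i t \<notin> range (spine p)"
  proof
    assume "F_gen p i t \<in> range (spine p)"
    then obtain m where m: "F_gen p i t = spine p m" by auto
    have "\<exists>l. F_gen p i (spine p l) = spine p m"
    proof (cases "i \<ge> 1 \<and> m \<le> 0")
      case True
      then show ?thesis using gen_spine[OF i, of m] by auto
    next
      case False
      show ?thesis
      proof (cases "m = 0")
        case True
        moreover have "i = 0" using True False by simp
        ultimately show ?thesis using F_gen_0_spine[OF p, of 1] by (intro exI[of _ 1]) simp
      next
        case m: False
        then show ?thesis using False gen_spine[OF i, of "m + 1"] by auto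
      qed
    qed
    then obtain l where "F_gen p i (spine p l) = F_gen p i t"
      using m by auto
    then have "t = spine p l"
      using F_adic_less_iff[OF gen_adic[OF i] t(1) unit[of l]]
        F_adic_less_iff[OF gen_adic[OF i] unit[of l] t(1)] by auto
    then show False using False by auto
  qed
  then have "label p (F_gen p i t) = 2"
    by (auto simp: label_def)
  moreover have "label p t = 2"
    using False by (auto simp: label_def)
  ultimately show ?thesis by simp
qed

text \<open>
  For a generator the exceptional point is $z_1$, for its inverse it is the image of $z_1$, whose label
  becomes that of $z_1$. Since $z_1$ has the middle label, the change is at most \<open>1\<close>.
\<close>
lemma label_letter:
  assumes "a \<in> letters p"
  obtains s where "\<And>t. t \<in> {0..1} \<Longrightarrow> \<bar>label p (a t) - label p t\<bar> \<le> (if t = s then 1 else 0)"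
proof -
  obtain i where i: "i \<le> p" and "a = F_gen p i \<or> a = inv_gen p i"
    using assms letters_iff by auto
  then consider "a = F_gen p i" | "a = inv_gen p i" by auto
  then show ?thesis
  proof cases
    case 1
    show ?thesis
    proof (rule that[of "spine p 1"])
      fix t :: real assume "t \<in> {0..1}"
      then show "\<bar>label p (a t) - label p t\<bar> \<le> (if t = spine p 1 then 1 else 0)"
        using label_gen[OF i, of t] 1 label_cases[of "a t"] by (auto simp: label_spine)
    qed
  next
    case 2
    show ?thesis
    proof (rule that[of "F_gen p i (spine p 1)"])
      fix t :: real assume t: "t \<in> {0..1}"
      then have at: "F_gen p i (a t) = t" "a t \<in> {0..1}"
        using 2 gen_inv_gen[OF i] F_adic_range[OF inv_gen_adic[OF i]] by auto
      show "\<bar>label p (a t) - label p t\<bar> \<le> (if t = F_gen p i (spine p 1) then 1 else 0)"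
      proof (cases "a t = spine p 1")
        case True
        then have "t = F_gen p i (spine p 1)" using at by simp
        then show ?thesis
          using label_cases[of t] label_spine[of 1] True by auto
      next
        case False
        then show ?thesis
          using label_gen[OF i at(2)] unfolding at(1) by simp
      qed
    qed
  qed
qed

text \<open>
  Different points have different positions at every time, so at most one of them is at the exceptional
  point of the next letter.
\<close>
lemma sum_variation_le_length:
  assumes "w \<in> lists (letters p)" "finite T" "T \<subseteq> {0..1}"
  shows "(\<Sum>t\<in>T. variation p w t) \<le> int (length w)"
  using assms(1)
proof (induction w rule: list.induct)
  case (Cons a w)
  then have w: "w \<in> lists (letters p)" and a: "a \<in> letters p" by auto
  then obtain s where s: "\<And>t. t \<in> {0..1} \<Longrightarrow> \<bar>label p (a t) - label p t\<bar> \<le> (if t = s then 1 else 0)"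
    using label_letter by blast
  have "(\<Sum>t\<in>T. \<bar>label p (a (run w t)) - label p (run w t)\<bar>) \<le> (\<Sum>t\<in>T. if run w t = s then 1 else 0)"
    using assms(3) run_unit[OF w] by (intro sum_mono s) auto
  also have "\<dots> \<le> 1"
    using inj_on_subset[OF run_inj[OF w] assms(3)] assms(2) by (rule sum_le_one_if_inj[rotated])
  finally have "(\<Sum>t\<in>T. \<bar>label p (a (run w t)) - label p (run w t)\<bar>) \<le> 1" .
  moreover have "(\<Sum>t\<in>T. variation p w t) \<le> int (length w)"
    using Cons.IH[OF w] .
  ultimately show ?case
    unfolding variation.simps sum.distrib by simp
next
  case Nil
  show ?case
    unfolding variation.simps by simp
qed

text \<open>
  Labels change in steps of one.
\<close>
lemma visits_label_1:
  assumes "w \<in> lists (letters p)" "t \<in> {0..1}" "label p t = 2" "label p (run w t) = 0"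
  obtains u v where "w = u @ v" "label p (run v t) = 1"
proof -
  have "\<exists>u v. w = u @ v \<and> label p (run v t) = 1"
    using assms(1,4)
  proof (induction w rule: list.induct)
    case Nil
    then show ?case using assms(3) by simp
  next
    case (Cons a w)
    then have a: "a \<in> letters p" and w: "w \<in> lists (letters p)" by auto
    obtain s where "\<And>t. t \<in> {0..1} \<Longrightarrow> \<bar>label p (a t) - label p t\<bar> \<le> (if t = s then 1 else 0)"
      using label_letter[OF a] by blast
    from this[OF run_unit[OF w assms(2)]] have "label p (run w t) \<noteq> 2"
      using Cons.prems(2) by (auto split: if_splits)
    then consider "label p (run w t) = 0" | "label p (run w t) = 1"
      using label_cases[of "run w t"] by auto
    then show ?case
    proof cases
      case 1
      then obtain u v where "w = u @ v" "label p (run v t) = 1"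
        using Cons.IH[OF w] by blast
      then show ?thesis by (intro exI[of _ "a # u"] exI[of _ v]) simp
    next
      case 2
      then show ?thesis by (intro exI[of _ "[a]"] exI[of _ w]) simp
    qed
  qed
  then show ?thesis using that by blast
qed

lemma child_pair_letter:
  assumes "a \<in> letters p" "child_pair p P E" "P \<noteq> spine p 0"
  shows "child_pair p (a P) (a E)"
  using assms child_pair_F_gen[OF _ p assms(2)] child_pair_inverse[OF _ p assms(2), folded inv_gen_def]
  by (auto simp: letters_iff)

text \<open>
  This forces a point to cross from one half of the spine to the other: a word can change the relative
  position in a child pair only while the first point of the pair is at $z_0$.
\<close>
lemma child_pair_visits_spine_0:
  assumes "w \<in> lists (letters p)" "child_pair p P E" "\<not> child_pair p (run w P) (run w E)"
  obtains u v where "w = u @ v" "run v P = spine p 0"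
proof -
  have "\<exists>u v. w = u @ v \<and> run v P = spine p 0"
    using assms(1,3)
  proof (induction w rule: list.induct)
    case Nil
    then show ?case using assms(2) by simp
  next
    case (Cons a w)
    show ?case
    proof (cases "child_pair p (run w P) (run w E)")
      case True
      then have "run w P = spine p 0"
        using child_pair_letter[of a "run w P" "run w E"] Cons.prems by auto
      then show ?thesis by (intro exI[of _ "[a]"] exI[of _ w]) simp
    next
      case False
      then obtain u v where "w = u @ v" "run v P = spine p 0"
        using Cons by auto
      then show ?thesis by (intro exI[of _ "a # u"] exI[of _ v]) simp
    qed
  qed
  then show ?thesis using that by blast
qed

text \<open>
  For $j \ge 1$ the distance is $p^2 / n^{j+2}$. If it equals $p / n^{w+1}$, then $p$ divides a power of
  $n = p + 1$, so $p = 1$ and $w = j + 1$; but then the interval at $z_j$ of length $n^{-w}$ ends in \<open>1\<close>.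
\<close>
lemma not_child_pair_spine:
  assumes "j \<ge> 1"
  shows "\<not> child_pair p (spine p j) (spine p (j + 1))"
proof
  assume "child_pair p (spine p j) (spine p (j + 1))"
  then obtain w where w: "spine p j + 1 / (real p + 1) ^ w < 1"
      "spine p (j + 1) = spine p j + real p / (real p + 1) ^ (w + 1)"
    unfolding child_pair_def by blast
  define N where "N = real p + 1"
  have N: "N > 1" using p by (simp add: N_def)
  obtain m where m: "j = int m" using assms nonneg_int_cases[of j] by auto
  have s: "spine p (int l) = 1 - real p / N ^ (l + 1)" if "l \<ge> 1" for l
  proof -
    have "- int l - 1 = - int (l + 1)" by simp
    then show ?thesis
      using that unfolding spine_def N_def[symmetric] 
      by (simp only: power_int_minus power_int_of_nat) (simp add: divide_inverse)
  qed
  have sm: "spine p j = 1 - real p / N ^ (m + 1)" "spine p (j + 1) = 1 - real p / N ^ (m + 2)"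
    using s[of m] s[of "m + 1"] m assms by (simp_all add: add.commute)
  have "real p / N ^ (w + 1) = real p / N ^ (m + 1) - real p / N ^ (m + 2)"
    using w(2) unfolding sm N_def[symmetric] by simp
  also have "\<dots> = real p * real p / N ^ (m + 2)"
    using N by (simp add: field_simps) (simp add: N_def algebra_simps)
  finally have "N ^ (m + 1) = real p * N ^ w"
    using N p by (simp add: field_simps)
  then have "real ((p + 1) ^ (m + 1)) = real (p * (p + 1) ^ w)"
    unfolding N_def of_nat_power of_nat_mult of_nat_add of_nat_1 .
  then have eq: "(p + 1) ^ (m + 1) = p * (p + 1) ^ w"
    by (simp only: of_nat_eq_iff)
  then have "p dvd (p + 1) ^ (m + 1)" by simp
  moreover have "coprime p ((p + 1) ^ (m + 1))"
    unfolding coprime_power_right_iff by simp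
  ultimately have "p = 1"
    using coprime_common_divisor[of p "(p + 1) ^ (m + 1)" p] by simp
  then have "N ^ (m + 1) = N ^ w"
    using \<open>N ^ (m + 1) = real p * N ^ w\<close> by simp
  then show False
    using w(1) unfolding sm N_def[symmetric] using \<open>p = 1\<close> by simp
qed

end

section \<open>The seesaw elements\<close>

text \<open>
  The power $x_0^{-j}$, written as the action of a word so that all facts about words apply to it. It moves
  the spine by $j$ positions to the right.
\<close>
definition shift :: "nat \<Rightarrow> int \<Rightarrow> real \<Rightarrow> real" where
  "shift p j = run (if j \<ge> 0 then replicate (nat j) (inv_gen p 0) else replicate (nat (- j)) (F_gen p 0))"

text \<open>
  The points in $(z_j, z_{j+1})$ that form child pairs with $z_j$; the letter $x_1^{-1}$ moves the one
  with $j = 0$ onto the spine.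
\<close>
definition child :: "nat \<Rightarrow> int \<Rightarrow> real" where
  "child p j = shift p j (F_gen p 1 (spine p 1))"

text \<open>
  This word exchanges points on and off the spine near $z_{-k}$ and fixes everything from $z_{3-k}$ on. It
  has to bring the points near $z_{-k}$ to $z_0$ first, and these can be moved by $x_0$ and its inverse only.
\<close>
definition left_word :: "nat \<Rightarrow> nat \<Rightarrow> (real \<Rightarrow> real) list" where
  "left_word p k = replicate k (F_gen p 0) @ [inv_gen p 1, inv_gen p 0, F_gen p 1] @
     replicate (k - 1) (inv_gen p 0)"

text \<open>
  This word brings $z_k, \dots, z_1$ to $z_0$ one after the other and each time moves the child of the point
  at $z_0$ onto the spine.
\<close>
definition right_word :: "nat \<Rightarrow> nat \<Rightarrow> (real \<Rightarrow> real) list" where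
  "right_word p k = concat (replicate k [inv_gen p 0, inv_gen p 1]) @ replicate k (F_gen p 0)"

context thompson_group
begin

lemma gens_in_letters: "i \<le> p \<Longrightarrow> F_gen p i \<in> letters p" "i \<le> p \<Longrightarrow> inv_gen p i \<in> letters p"
  by (auto simp: letters_iff)

lemma shift_word_letters:
  "(if j \<ge> 0 then replicate (nat j) (inv_gen p 0) else replicate (nat (- j)) (F_gen p 0)) \<in> lists (letters p)"
  using gens_in_letters[of 0] by (auto simp: in_lists_conv_set)

lemma shift_unit: "t \<in> {0..1} \<Longrightarrow> shift p j t \<in> {0..1}"
  unfolding shift_def using run_unit[OF shift_word_letters] .

lemma shift_less: "s \<in> {0..1} \<Longrightarrow> t \<in> {0..1} \<Longrightarrow> shift p j s < shift p j t \<longleftrightarrow> s < t"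
  unfolding shift_def using run_less[OF shift_word_letters] .

lemma shift_le: "s \<in> {0..1} \<Longrightarrow> t \<in> {0..1} \<Longrightarrow> shift p j s \<le> shift p j t \<longleftrightarrow> s \<le> t"
  using shift_less[of t s j] by linarith

lemma shift_0 [simp]: "shift p 0 t = t"
  by (simp add: shift_def)

lemma inv_gen_shift:
  assumes "t \<in> {0..1}"
  shows "inv_gen p 0 (shift p j t) = shift p (j + 1) t"
proof (cases "j \<ge> 0")
  case True
  then have "nat (j + 1) = Suc (nat j)" by simp
  then show ?thesis using True by (simp add: shift_def)
next
  case False
  define m where "m = nat (- j - 1)"
  have m: "nat (- j) = Suc m" "nat (- (j + 1)) = m"
    using False by (auto simp: m_def)
  define t' where "t' = run (replicate m (F_gen p 0)) t"
  have "t' \<in> {0..1}"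
    unfolding t'_def using gens_in_letters[of 0] assms
    by (intro run_unit) (auto simp: in_lists_conv_set)
  then have "inv_gen p 0 (F_gen p 0 t') = t'"
    using gen_inv_gen by simp
  moreover have "shift p j t = F_gen p 0 t'"
    using False m by (simp add: shift_def t'_def)
  moreover have "shift p (j + 1) t = t'"
    using False m by (cases "j = - 1") (auto simp: shift_def t'_def)
  ultimately show ?thesis by simp
qed

lemma gen_shift:
  assumes "t \<in> {0..1}"
  shows "F_gen p 0 (shift p j t) = shift p (j - 1) t"
  using inv_gen_shift[OF assms, of "j - 1"] gen_inv_gen(1)[of 0 "shift p (j - 1) t"]
    shift_unit[OF assms] by simp

lemma run_gens_shift:
  assumes "t \<in> {0..1}"
  shows "run (replicate m (F_gen p 0)) (shift p j t) = shift p (j - int m) t"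
    "run (replicate m (inv_gen p 0)) (shift p j t) = shift p (j + int m) t"
  by (induction m) (simp_all add: gen_shift[OF assms] inv_gen_shift[OF assms] algebra_simps)

lemma run_gens:
  assumes "t \<in> {0..1}"
  shows "run (replicate m (F_gen p 0)) t = shift p (- int m) t"
    "run (replicate m (inv_gen p 0)) t = shift p (int m) t"
  using run_gens_shift[OF assms, of m 0] by simp_all

lemma shift_shift:
  assumes "t \<in> {0..1}"
  shows "shift p i (shift p j t) = shift p (i + j) t"
  using run_gens_shift[OF assms, of _ j]
  by (cases "i \<ge> 0") (simp_all add: shift_def[of p i] add.commute)

lemma shift_spine: "shift p i (spine p j) = spine p (i + j)"
proof -
  have "shift p i (spine p 0) = spine p i" for i
  proof (induction i rule: int_induct[where k = 0])
    case base
    then show ?case by simp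
  next
    case (step1 i)
    have "F_gen p 0 (spine p (i + 1)) = spine p i"
      using F_gen_0_spine[OF p, of "i + 1"] by simp
    then have "spine p (i + 1) = inv_gen p 0 (spine p i)"
      using gen_inv_gen(2)[of 0 "spine p (i + 1)"] unit by simp
    then show ?case
      using step1 inv_gen_shift[OF unit[of 0], of i] by simp
  next
    case (step2 i)
    then show ?case
      using gen_shift[OF unit[of 0], of i] F_gen_0_spine[OF p, of i] by simp
  qed
  then show ?thesis
    using shift_shift[OF unit[of 0], of i j] by simp
qed

lemma gen_0_eq: "t \<in> {0..1} \<Longrightarrow> F_gen p 0 t = shift p (- 1) t"
  using gen_shift[of t 0] by simp

lemma inv_gen_0_eq: "t \<in> {0..1} \<Longrightarrow> inv_gen p 0 t = shift p 1 t"
  using inv_gen_shift[of t 0] by simp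

lemma gen_low:
  assumes "1 \<le> i" "i \<le> p" "t \<in> {0..1}" "t \<le> spine p 0"
  shows "F_gen p i t = t" "inv_gen p i t = t"
  using F_gen_fixes_low[OF assms(1,2)] gen_inv_gen(2)[OF assms(2,3)] assms(3,4) by auto

lemma gen_high:
  assumes "1 \<le> i" "i \<le> p" "t \<in> {0..1}" "spine p 2 \<le> t"
  shows "F_gen p i t = shift p (- 1) t"
  using F_gen_eq_high[OF assms(1,2,4)] assms(3) gen_0_eq by auto

text \<open>
  Already from $z_1$ on, since $x_0^{-1}$ moves $z_1$ to $z_2$, where $x_i$ and $x_0$ start to agree.
\<close>
lemma inv_gen_high:
  assumes "1 \<le> i" "i \<le> p" "t \<in> {0..1}" "spine p 1 \<le> t"
  shows "inv_gen p i t = shift p 1 t"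
proof -
  have s: "shift p 1 t \<in> {0..1}" "spine p 2 \<le> shift p 1 t"
    using shift_unit[OF assms(3)] shift_le[OF unit[of 1] assms(3), of 1] assms(4)
    by (simp_all add: shift_spine)
  then have "F_gen p i (shift p 1 t) = t"
    using gen_high[OF assms(1,2) s] shift_shift[OF assms(3), of "- 1" 1] by simp
  then show ?thesis
    using gen_inv_gen(2)[OF assms(2) s(1)] by simp
qed

lemma gen_spine_1_between:
  assumes "1 \<le> i" "i \<le> p"
  shows "spine p 0 < F_gen p i (spine p 1)" "F_gen p i (spine p 1) < spine p 1"
proof -
  note L = F_adic_less_iff[OF gen_adic[OF assms(2)] unit unit]
  show "spine p 0 < F_gen p i (spine p 1)"
    using L[of 0 1] gen_low(1)[OF assms unit[of 0]] by (simp add: spine_iffs)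
  show "F_gen p i (spine p 1) < spine p 1"
    using L[of 1 2] gen_high[OF assms unit[of 2]] by (simp add: spine_iffs shift_spine)
qed

lemma shift_between:
  assumes "spine p 0 < t" "t < spine p 1"
  shows "spine p j < shift p j t" "shift p j t < spine p (j + 1)"
proof -
  have "t \<in> {0..1}"
    using assms unit[of 0] unit[of 1] by auto
  then show "spine p j < shift p j t" "shift p j t < spine p (j + 1)"
    using shift_less[OF unit[of 0], of t j] shift_less[OF _ unit[of 1], of t j] assms
    by (simp_all add: shift_spine)
qed

lemma child_unit: "child p j \<in> {0..1}"
  unfolding child_def using gen_spine_1_between[of 1] p unit[of 0] unit[of 1]
  by (intro shift_unit) auto

lemma child_between: "spine p j < child p j" "child p j < spine p (j + 1)"
  unfolding child_def using shift_between gen_spine_1_between[of 1] p by auto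

lemma shift_child: "shift p i (child p j) = child p (i + j)"
  unfolding child_def using shift_shift gen_spine_1_between[of 1] p unit[of 0] unit[of 1] by auto

lemma label_child: "label p (child p j) = 2"
  using lab(2) child_between by blast

lemmas labels = lab label_child

lemma inv_gen_child_0: "inv_gen p 1 (child p 0) = spine p 1"
  using gen_inv_gen(2)[of 1 "spine p 1"] p unit by (simp add: child_def)

text \<open>
  It suffices to consider $j = 0$, as $x_0$ and its inverse preserve child pairs. The interval
  to the right of $z_0 = 1/n$ has length $1/n$ if $p \ge 2$ but $1/4$ if $p = 1$, because $[1/2, 1]$ touches \<open>1\<close>.
\<close>
lemma child_pair_children: "child_pair p (spine p j) (child p j)"
proof -
  define N where "N = real p + 1"
  have N: "N > 0" by (simp add: N_def)
  have s0: "spine p 0 = 1 / N"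
    by (simp add: spine_def N_def power_int_minus divide_inverse)
  have s1: "spine p 1 = 1 - real p / N ^ 2"
    by (simp add: spine_def N_def power_int_minus divide_inverse)
  have c0: "child p 0 = F_gen p 1 (spine p 1)" by (simp add: child_def)
  have base: "child_pair p (spine p 0) (child p 0)"
  proof (cases "p = 1")
    case True
    have b: "bp1 p 1 = 1 / 2" "bp2 p 1 = 3 / 4"
      using True by (simp_all add: bp1_def bp2_def)
    have N2: "N = 2" using True by (simp add: N_def)
    have "F_gen p 1 (spine p 1) = 5 / 8"
    proof -
      have s1': "spine p 1 = 3 / 4"
        using s1 True by (simp add: N2)
      have "F_gen p 1 (spine p 1) = bp1 p 1 + (spine p 1 - bp1 p 1) / (real p + 1)"
        using p unit[of 1] by (intro F_gen_pieces(2)) (auto simp: b[unfolded One_nat_def] s1')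
      also have "\<dots> = 5 / 8"
        unfolding b s1' using True by simp
      finally show ?thesis .
    qed
    then show ?thesis
      unfolding child_pair_def c0 s0 N_def[symmetric] N2
      by (intro exI[of _ 2] exI[of _ 2]) (simp add: True)
  next
    case False
    then have p2: "p \<ge> 2" using p by simp
    have b: "bp1 p 1 = 1 / N" "bp2 p 1 = real p / N"
      using p2 by (simp_all add: bp1_def bp2_def N_def)
    have d: "bp2 p 1 - bp1 p 1 = (real p - 1) / N"
      unfolding b by (simp add: diff_divide_distrib)
    have le1: "bp2 p 1 \<le> spine p 1"
    proof -
      have "spine p 1 - bp2 p 1 = 1 / N ^ 2"
      proof -
        have pN: "real p / N = 1 - 1 / N"
          by (simp add: N_def divide_simps)
        have "real p / N ^ 2 = real p / N / N"
          by (simp add: power2_eq_square)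
        then show ?thesis
          unfolding b s1 pN by (simp add: diff_divide_distrib power2_eq_square)
      qed
      also have "\<dots> > 0"
        using N by simp
      finally show ?thesis by simp
    qed
    have "bp3 p 1 = 1 - (real p - 1) / N ^ 2"
      unfolding bp3_def d N_def[symmetric] by (simp add: power2_eq_square)
    then have le2: "spine p 1 \<le> bp3 p 1"
      unfolding s1 by (simp add: divide_right_mono)
    have "F_gen p 1 (spine p 1) = spine p 1 - (bp2 p 1 - bp1 p 1) * real p / N"
      using F_gen_pieces(3)[of 1 p "spine p 1"] le1 le2 p unit[of 1] by (simp add: N_def)
    also have "\<dots> = 1 / N + real p / N ^ 2"
      unfolding d s1 using N by (simp add: N_def divide_simps power2_eq_square) (simp add: algebra_simps)
    finally have "child p 0 = 1 / N + real p / N ^ (1 + 1)"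
      by (simp add: c0 power2_eq_square)
    moreover have "1 / N + 1 / N < 1"
      using p2 by (simp add: N_def)
    ultimately show ?thesis
      unfolding child_pair_def s0 N_def[symmetric] using N
      by (intro exI[of _ 1] exI[of _ 1]) simp
  qed
  show ?thesis
  proof (induction j rule: int_induct[where k = 0])
    case base
    then show ?case using \<open>child_pair p (spine p 0) (child p 0)\<close> .
  next
    case (step1 i)
    then have "child_pair p (inv_gen p 0 (spine p i)) (inv_gen p 0 (child p i))"
      unfolding inv_gen_def by (intro child_pair_inverse p) auto
    then show ?case
      using inv_gen_0_eq[OF unit[of i]] inv_gen_0_eq[OF child_unit[of i]]
      by (simp add: shift_spine shift_child add.commute)
  next
    case (step2 i)
    then have "child_pair p (F_gen p 0 (spine p i)) (F_gen p 0 (child p i))"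
      by (intro child_pair_F_gen p) auto
    then show ?case
      using gen_0_eq[OF unit[of i]] gen_0_eq[OF child_unit[of i]] by (simp add: shift_spine shift_child)
  qed
qed

lemma left_word_letters: "left_word p k \<in> lists (letters p)"
  and right_word_letters: "right_word p k \<in> lists (letters p)"
  using gens_in_letters[of 0] gens_in_letters[of 1] p
  by (auto simp: left_word_def right_word_def in_lists_conv_set)

lemma length_words:
  "k \<ge> 1 \<Longrightarrow> length (left_word p k) = 2 * k + 2" "length (right_word p k) = 3 * k"
  by (simp_all add: left_word_def right_word_def length_concat sum_list_replicate)

text \<open>
  As long as the point has not passed $z_0$, the letters $x_1^{-1}$ fix it.
\<close>
lemma run_pairs_low:
  assumes "t \<in> {0..1}" "t \<le> spine p (1 - int m)"
  shows "run (concat (replicate m [inv_gen p 0, inv_gen p 1])) t = shift p (int m) t"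
  using assms(2)
proof (induction m)
  case (Suc m)
  have "spine p (1 - int (Suc m)) \<le> spine p (1 - int m)"
    by (simp add: spine_iffs)
  then have IH: "run (concat (replicate m [inv_gen p 0, inv_gen p 1])) t = shift p (int m) t"
    using Suc by simp
  have "shift p (int m) t \<le> spine p 0"
    using shift_le[OF assms(1) unit, of "int m" "1 - int (Suc m)"] Suc.prems by (simp add: shift_spine)
  then have "inv_gen p 1 (shift p (int m) t) = shift p (int m) t"
    using gen_low(2)[of 1] p shift_unit[OF assms(1)] by simp
  then show ?case
    using IH inv_gen_shift[OF assms(1), of "int m"] by (simp add: add.commute)
qed simp

lemma run_pairs_spine:
  assumes "j \<ge> 1"
  shows "run (concat (replicate m [inv_gen p 0, inv_gen p 1])) (spine p j) = spine p (j + 2 * int m)"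
proof (induction m)
  case (Suc m)
  have "inv_gen p 1 (spine p (j + 2 * int m)) = spine p (j + 2 * int m + 1)"
    using inv_gen_high[of 1 "spine p (j + 2 * int m)"] p unit assms by (simp add: spine_iffs shift_spine add.commute)
  then show ?case
    using Suc inv_gen_0_eq[OF unit] by (simp add: shift_spine algebra_simps)
qed simp

lemma right_word_low:
  assumes "t \<in> {0..1}" "t \<le> spine p 1"
  shows "run (right_word p k) t = t"
proof -
  let ?s = "shift p (- int k) t"
  have "?s \<le> spine p (1 - int k)"
    using shift_le[OF assms(1) unit, of "- int k" 1] assms(2) by (simp add: shift_spine)
  then have "run (right_word p k) t = shift p (int k) ?s"
    using run_pairs_low[OF shift_unit[OF assms(1)]] run_gens(1)[OF assms(1)] by (simp add: right_word_def)
  then show ?thesis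
    by (simp add: shift_shift[OF assms(1)])
qed

text \<open>
  The final $x_0^k$ and $k - j$ of the pairs, in which $x_1^{-1}$ acts trivially, bring $z_j$ to $z_0$ and
  its child to the child of $z_0$. The next pair moves the child onto the spine. From then on both points are
  to the right of $z_0$ and every pair moves them by two positions.
\<close>
lemma right_word_spine_child:
  assumes "1 \<le> j" "j \<le> k"
  shows "run (right_word p k) (spine p (int j)) = spine p (2 * int j - 1)"
    "run (right_word p k) (child p (int j)) = spine p (2 * int j)"
proof -
  let ?W = "\<lambda>m. concat (replicate m [inv_gen p 0, inv_gen p 1])"
  \<comment> \<open>There are \<open>b\<close> trivial pairs, the pair that acts on the child, and \<open>a\<close> further pairs.\<close>
  obtain a b where ab: "j = Suc a" "k = a + Suc b"
    using assms that[of "j - 1" "k - j"] by simp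
  have split: "right_word p k = ?W a @ [inv_gen p 0, inv_gen p 1] @ ?W b @ replicate k (F_gen p 0)"
    unfolding right_word_def ab(2) replicate_add by simp
  have expand: "run (right_word p k) s = run (?W a) (inv_gen p 0 (inv_gen p 1
      (run (?W b) (run (replicate k (F_gen p 0)) s))))" for s
    unfolding split by (simp only: foldr_append foldr.simps o_apply id_apply)
  have e: "int j - int k = - int b" using ab by simp
  have "run (replicate k (F_gen p 0)) (spine p (int j)) = spine p (- int b)"
    using run_gens(1)[OF unit, of k "int j"] e by (simp add: shift_spine)
  moreover have "run (?W b) (spine p (- int b)) = spine p 0"
    using run_pairs_low[OF unit, of "- int b" b] by (simp add: spine_iffs shift_spine)
  moreover have "inv_gen p 1 (spine p 0) = spine p 0"
    using gen_low(2)[of 1 "spine p 0"] p unit by simp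
  moreover have "inv_gen p 0 (spine p 0) = spine p 1"
    using inv_gen_0_eq[OF unit[of 0]] by (simp add: shift_spine)
  ultimately show "run (right_word p k) (spine p (int j)) = spine p (2 * int j - 1)"
    using run_pairs_spine[of 1 a] ab(1) unfolding expand by (simp add: algebra_simps)
  have "run (replicate k (F_gen p 0)) (child p (int j)) = child p (- int b)"
    using run_gens(1)[OF child_unit, of k "int j"] e by (simp add: shift_child)
  moreover have "run (?W b) (child p (- int b)) = child p 0"
    using run_pairs_low[OF child_unit, of "- int b" b] child_between(2)[of "- int b"]
    by (simp add: shift_child)
  moreover have "inv_gen p 0 (spine p 1) = spine p 2"
    using inv_gen_0_eq[OF unit[of 1]] by (simp add: shift_spine)
  ultimately show "run (right_word p k) (child p (int j)) = spine p (2 * int j)"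
    using run_pairs_spine[of 2 a] ab(1) inv_gen_child_0 unfolding expand by (simp add: algebra_simps)
qed

lemma left_word_run:
  assumes "t \<in> {0..1}" "k \<ge> 1"
  shows "run (left_word p k) t =
    shift p (- int k) (inv_gen p 1 (inv_gen p 0 (F_gen p 1 (shift p (int k - 1) t))))"
proof -
  let ?s = "shift p (int k - 1) t"
  have "run (replicate (k - 1) (inv_gen p 0)) t = ?s"
    using run_gens(2)[OF assms(1), of "k - 1"] assms(2) by (simp add: of_nat_diff)
  moreover have "inv_gen p 1 (inv_gen p 0 (F_gen p 1 ?s)) \<in> {0..1}"
    using run_unit[of "[inv_gen p 1, inv_gen p 0, F_gen p 1]"] gens_in_letters p
      shift_unit[OF assms(1)] by simp
  ultimately show ?thesis
    using run_gens(1) by (simp add: left_word_def)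
qed

lemma left_word_high:
  assumes "t \<in> {0..1}" "spine p (3 - int k) \<le> t" "k \<ge> 1"
  shows "run (left_word p k) t = t"
proof -
  let ?s = "shift p (int k - 1) t"
  have s: "?s \<in> {0..1}" "spine p 2 \<le> ?s"
    using shift_unit[OF assms(1)] shift_le[OF unit assms(1), of "int k - 1" "3 - int k"] assms(2)
    by (simp_all add: shift_spine)
  have "F_gen p 1 ?s = shift p (- 1) ?s"
    using gen_high[of 1 ?s] s p by simp
  then have "inv_gen p 0 (F_gen p 1 ?s) = ?s"
    using inv_gen_shift[OF s(1), of "- 1"] by simp
  moreover have "spine p 1 \<le> ?s"
    using s(2) spine_iffs(2)[of 1 2] by linarith
  then have "inv_gen p 1 ?s = shift p 1 ?s"
    using inv_gen_high[of 1 ?s] s p by simp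
  ultimately show ?thesis
    using left_word_run[OF assms(1,3)] by (simp add: shift_shift[OF assms(1)] shift_shift[OF s(1)])
qed

lemma left_word_child:
  assumes "k \<ge> 1"
  shows "run (left_word p k) (child p (- int k)) = spine p (1 - int k)"
proof -
  have "shift p (int k - 1) (child p (- int k)) = child p (- 1)"
    by (simp add: shift_child)
  moreover have "F_gen p 1 (child p (- 1)) = child p (- 1)"
    using gen_low(1)[of 1, OF _ _ child_unit] child_between(2)[of "-1"] p by simp
  moreover have "inv_gen p 0 (child p (- 1)) = child p 0"
    using inv_gen_0_eq[OF child_unit[of "-1"]] by (simp add: shift_child)
  ultimately show ?thesis
    using left_word_run[OF child_unit assms] inv_gen_child_0 by (simp add: shift_spine)
qed

text \<open>
  The point $z_{1-k}$ moves to $z_{2-k}$, the point $z_{2-k}$ moves off the spine, and the points from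
  $z_{3-k}$ on are fixed.
\<close>
lemma left_word_spine_label:
  assumes "1 - int k \<le> m" "m \<le> 0" "k \<ge> 2"
  shows "label p (run (left_word p k) (spine p m)) \<noteq> 1"
proof -
  have k: "k \<ge> 1" using assms by simp
  note run = left_word_run[OF unit k]
  consider "m = 1 - int k" | "m = 2 - int k" | "3 - int k \<le> m" using assms by linarith
  then show ?thesis
  proof cases
    case 1
    have "F_gen p 1 (spine p 0) = spine p 0"
      using gen_low(1)[of 1, OF _ _ unit] p by simp
    moreover have "inv_gen p 0 (spine p 0) = spine p 1"
      using inv_gen_0_eq[OF unit[of 0]] by (simp add: shift_spine)
    moreover have "inv_gen p 1 (spine p 1) = spine p 2"
      using inv_gen_high[of 1, OF _ _ unit] p by (simp add: shift_spine)
    ultimately have "run (left_word p k) (spine p m) = spine p (2 - int k)"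
      using run[of m] 1 by (simp add: shift_spine)
    then show ?thesis using assms by (simp add: lab)
  next
    case 2
    have "F_gen p 1 (spine p 1) = child p 0"
      by (simp add: child_def)
    moreover have "inv_gen p 0 (child p 0) = child p 1"
      using inv_gen_0_eq[OF child_unit[of 0]] by (simp add: shift_child)
    moreover have "inv_gen p 1 (child p 1) = child p 2"
      using inv_gen_high[of 1, OF _ _ child_unit] child_between(1)[of 1] p by (simp add: shift_child)
    ultimately have "run (left_word p k) (spine p m) = child p (2 - int k)"
      using run[of m] 2 by (simp add: shift_spine shift_child)
    then show ?thesis by (simp add: label_child)
  next
    case 3
    then have "run (left_word p k) (spine p m) = spine p m"
      by (intro left_word_high unit k) (simp add: spine_iffs)
    then show ?thesis using assms by (simp add: lab)
  qed
qed

text \<open>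
  The supports are separated by $z_1$, which both words fix.
\<close>
lemma words_commute:
  assumes "t \<in> {0..1}" "k \<ge> 2"
  shows "run (right_word p k @ left_word p k) t = run (left_word p k @ right_word p k) t"
proof -
  have k: "k \<ge> 1" using assms by simp
  have s: "spine p (3 - int k) \<le> spine p 1"
    using assms by (simp add: spine_iffs)
  note L = run_less[OF left_word_letters[of k]] and R = run_less[OF right_word_letters[of k]]
  show ?thesis
  proof (cases "t \<le> spine p 1")
    case True
    have "run (left_word p k) (spine p 1) = spine p 1"
      using left_word_high[OF unit s k] .
    then have "run (left_word p k) t \<le> spine p 1"
      using L[OF unit[of 1] assms(1)] True by simp
    then show ?thesis
      using right_word_low[OF assms(1) True] right_word_low[OF run_unit[OF left_word_letters assms(1)]]
      by simp
  next
    case False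
    have "run (right_word p k) (spine p 1) = spine p 1"
      using right_word_low[OF unit] by simp
    then have "spine p 1 \<le> run (right_word p k) t"
      using R[OF assms(1) unit[of 1]] False by simp
    then show ?thesis
      using left_word_high[OF assms(1) _ k] left_word_high[OF run_unit[OF right_word_letters assms(1)] _ k]
        s False by simp
  qed
qed

end

section \<open>Geodesics of the seesaw elements\<close>

definition seesaw_word :: "nat \<Rightarrow> nat \<Rightarrow> (real \<Rightarrow> real) list" where
  "seesaw_word p k = left_word p k @ right_word p k"

definition represents_seesaw :: "nat \<Rightarrow> nat \<Rightarrow> (real \<Rightarrow> real) list \<Rightarrow> bool" where
  "represents_seesaw p k w \<longleftrightarrow> w \<in> lists (letters p) \<and> (\<forall>t\<in>{0..1}. run w t = run (seesaw_word p k) t)"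

definition crossed_points :: "nat \<Rightarrow> nat \<Rightarrow> real set" where
  "crossed_points p k =
     spine p ` {1 - int k..int k} \<union> child p ` {1..int k} \<union> {child p (- int k)}"

text \<open>
  The variation of the label that is forced at \<open>t\<close> for every word that represents the seesaw element.
\<close>
definition weight :: "nat \<Rightarrow> nat \<Rightarrow> real \<Rightarrow> int" where
  "weight p k t = (if t \<in> spine p ` {1 - int k..int k} \<union> {child p (- int k)} then 2
     else if t \<in> child p ` {1..int k} then 1 else 0)"

lemma variation_visit:
  "\<bar>label p (run v t) - label p t\<bar> + \<bar>label p (run (u @ v) t) - label p (run v t)\<bar>
     \<le> variation p (u @ v) t"
  using variation_ge[of p v t] variation_ge[of p u "run v t"] by (simp add: variation_append)

lemma variation_nonneg: "0 \<le> variation p w t"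
  using variation_ge[of p w t] by linarith

context thompson_group
begin

context
  fixes k :: nat
  assumes k: "k \<ge> 3"
begin

lemma seesaw_word_letters: "seesaw_word p k \<in> lists (letters p)"
  using left_word_letters right_word_letters by (simp add: seesaw_word_def)

lemma length_seesaw_word: "length (seesaw_word p k) = 5 * k + 2"
  using length_words[of k] k by (simp add: seesaw_word_def)

lemma seesaw_low: "t \<in> {0..1} \<Longrightarrow> t \<le> spine p 1 \<Longrightarrow> run (seesaw_word p k) t = run (left_word p k) t"
  using right_word_low by (simp add: seesaw_word_def)

lemma seesaw_fixed:
  assumes "spine p (3 - int k) \<le> t" "t \<le> spine p 1"
  shows "run (seesaw_word p k) t = t"
proof -
  have "t \<in> {0..1}"
    using assms unit[of 1] unit[of "3 - int k"] by auto
  then show ?thesis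
    using seesaw_low left_word_high[OF _ assms(1)] assms k by simp
qed

lemma seesaw_right:
  assumes "1 \<le> j" "j \<le> k"
  shows "run (seesaw_word p k) (spine p (int j)) = spine p (2 * int j - 1)"
    "run (seesaw_word p k) (child p (int j)) = spine p (2 * int j)"
  using right_word_spine_child[OF assms] left_word_high[OF unit] assms k
  by (simp_all add: seesaw_word_def spine_iffs)

lemma represents_seesawD:
  assumes "represents_seesaw p k w"
  shows "w \<in> lists (letters p)" "t \<in> {0..1} \<Longrightarrow> run w t = run (seesaw_word p k) t"
  using assms by (auto simp: represents_seesaw_def)

text \<open>
  The end position of the pair is a pair of consecutive points of the spine, not a child pair. Taking
  out the first part \<open>v\<close> of the motion allows to place the visit after a given time.
\<close>
lemma right_spine_visits_0:
  assumes w: "represents_seesaw p k (u @ v)" and j: "1 \<le> j" "j \<le> k"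
    and ch: "child_pair p (run v (spine p (int j))) (run v (child p (int j)))"
  obtains u1 u2 where "u = u1 @ u2" "run u2 (run v (spine p (int j))) = spine p 0"
proof (rule child_pair_visits_spine_0[OF _ ch])
  show "u \<in> lists (letters p)"
    using represents_seesawD(1)[OF w] by simp
  have "run u (run v (spine p (int j))) = spine p (2 * int j - 1)"
    "run u (run v (child p (int j))) = spine p (2 * int j)"
    using represents_seesawD(2)[OF w] seesaw_right[OF j] unit child_unit by simp_all
  then show "\<not> child_pair p (run u (run v (spine p (int j)))) (run u (run v (child p (int j))))"
    using not_child_pair_spine[of "2 * int j - 1"] j by simp
qed (use that in blast)

text \<open>
  A point $z_j$ with $1 \le j \le k$ starts and ends in the right half of the spine and visits the left half.
  Its child starts off the spine and ends on it. The child of $z_{-k}$ starts off the spine and ends in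
  the left half, so it passes through the right half; at this time the points $z_m$ with $1 - k \le m \le 0$,
  being larger, are not in the left half, where they start. They do not end in the right half.
\<close>
lemma variation_ge_weight:
  assumes w: "represents_seesaw p k w"
  shows "weight p k t \<le> variation p w t"
proof -
  note wl = represents_seesawD(1)[OF w] and eq = represents_seesawD(2)[OF w]
  have Rt: "2 \<le> variation p w (spine p (int j))" if j: "1 \<le> j" "j \<le> k" for j
  proof -
    obtain u1 u2 where u: "w = u1 @ u2" "run u2 (spine p (int j)) = spine p 0"
      using right_spine_visits_0[of w "[]" j] w j child_pair_children by auto
    have "run (u1 @ u2) (spine p (int j)) = spine p (2 * int j - 1)"
      using eq[OF unit] seesaw_right[OF j] u(1) by simp
    then show ?thesis
      using variation_visit[of p u2 "spine p (int j)" u1] j unfolding u by (simp add: labels)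
  qed
  have C: "1 \<le> variation p w (child p (int j))" if j: "1 \<le> j" "j \<le> k" for j
    using variation_ge[of p w "child p (int j)"] eq[OF child_unit] seesaw_right(2)[OF j] j
    by (simp add: labels)
  have lc: "run w (child p (- int k)) = spine p (1 - int k)"
  proof -
    have "child p (- int k) \<le> spine p 1"
      using child_between(2)[of "- int k"] spine_iffs(2)[of "1 - int k" 1] k by simp
    then show ?thesis
      using eq[OF child_unit] seesaw_low[OF child_unit] left_word_child k by simp
  qed
  then have D: "2 \<le> variation p w (child p (- int k))"
    using variation_ge[of p w "child p (- int k)"] k by (simp add: labels)
  have S: "2 \<le> variation p w (spine p m)" if m: "1 - int k \<le> m" "m \<le> 0" for m
  proof -
    obtain u v where uv: "w = u @ v" "label p (run v (child p (- int k))) = 1"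
      using visits_label_1[OF wl child_unit, of "- int k"] lc k by (auto simp: labels)
    have vl: "v \<in> lists (letters p)" using wl uv(1) by simp
    have "child p (- int k) < spine p (1 - int k)"
      using child_between(2)[of "- int k"] by simp
    also have "\<dots> \<le> spine p m"
      using m by (simp add: spine_iffs)
    finally have "run v (child p (- int k)) < run v (spine p m)"
      using run_less[OF vl child_unit unit] by simp
    moreover have "spine p 1 \<le> run v (child p (- int k))"
      using label_1_ge[OF uv(2)] .
    ultimately have "label p (run v (spine p m)) \<noteq> 0"
      using label_0_le[of "run v (spine p m)"] spine_iffs(1)[of 0 1] by fastforce
    moreover have "label p (run w (spine p m)) \<noteq> 1"
    proof -
      have "spine p m \<le> spine p 1" using m by (simp add: spine_iffs)
      then show ?thesis
        using eq[OF unit] seesaw_low[OF unit] left_word_spine_label[OF m] k by simp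
    qed
    ultimately show ?thesis
      using variation_visit[of p v "spine p m" u] label_cases[of "run v (spine p m)"]
        label_cases[of "run w (spine p m)"] m
      unfolding uv(1)[symmetric] by (auto simp: labels)
  qed
  have "2 \<le> variation p w (spine p m)" if "1 - int k \<le> m" "m \<le> int k" for m
    using S[of m] Rt[of "nat m"] that by (cases "m \<le> 0") auto
  moreover have "1 \<le> variation p w (child p m)" if "1 \<le> m" "m \<le> int k" for m
    using C[of "nat m"] that by auto
  ultimately show ?thesis
    using D variation_nonneg[of p w t] by (auto simp: weight_def)
qed

lemma child_eq_iff: "child p i = child p j \<longleftrightarrow> i = j"
proof
  assume eq: "child p i = child p j"
  have "spine p i < spine p (j + 1)" "spine p j < spine p (i + 1)"
    using child_between[of i] child_between[of j] eq by linarith+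
  then show "i = j"
    by (simp add: spine_iffs)
qed simp

lemma child_neq_spine: "child p i \<noteq> spine p j"
  using labels(3)[of i] labels(1)[of j] by (auto split: if_splits)

lemma crossed_points_finite: "finite (crossed_points p k)" "crossed_points p k \<subseteq> {0..1}"
  using unit child_unit by (auto simp: crossed_points_def)

lemma sum_weight: "(\<Sum>t\<in>crossed_points p k. weight p k t) = int (5 * k + 2)"
proof -
  let ?S = "spine p ` {1 - int k..int k}" and ?C = "child p ` {1..int k}" and ?c = "child p (- int k)"
  have inj: "inj_on (spine p) A" "inj_on (child p) A" for A
    by (auto simp: inj_on_def spine_iffs child_eq_iff)
  have disj: "?S \<inter> ?C = {}" "?c \<notin> ?S \<union> ?C"
    using child_neq_spine by (auto simp: child_eq_iff) metis+
  have "(\<Sum>t\<in>crossed_points p k. weight p k t)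
      = (\<Sum>t\<in>?S. weight p k t) + (\<Sum>t\<in>?C. weight p k t) + weight p k ?c"
    unfolding crossed_points_def using disj by (simp add: sum.union_disjoint)
  also have "(\<Sum>t\<in>?S. weight p k t) = (\<Sum>t\<in>?S. 2)"
    by (rule sum.cong) (auto simp: weight_def)
  also have "\<dots> = int (4 * k)"
    using k by (simp add: card_image inj)
  also have "(\<Sum>t\<in>?C. weight p k t) = (\<Sum>t\<in>?C. 1)"
    using disj by (intro sum.cong) (auto simp: weight_def child_eq_iff)
  also have "\<dots> = int k"
    by (simp add: card_image inj)
  also have "weight p k ?c = 2"
    by (simp add: weight_def)
  finally show ?thesis by simp
qed

lemma length_ge:
  assumes w: "represents_seesaw p k w"
  shows "5 * k + 2 \<le> length w"
proof -
  have "int (5 * k + 2) \<le> (\<Sum>t\<in>crossed_points p k. variation p w t)"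
    unfolding sum_weight[symmetric] by (intro sum_mono variation_ge_weight w)
  also have "\<dots> \<le> int (length w)"
    using sum_variation_le_length[OF represents_seesawD(1)[OF w]] crossed_points_finite .
  finally show ?thesis by simp
qed

text \<open>
  For a word of minimal length there is equality in the estimate \<open>sum_variation_le_length\<close>, even after
  adding any single point to the sum.
\<close>
lemma variation_le_weight:
  assumes w: "represents_seesaw p k w" and len: "length w = 5 * k + 2" and t: "t \<in> {0..1}"
  shows "variation p w t \<le> weight p k t"
proof (rule ccontr)
  assume less: "\<not> variation p w t \<le> weight p k t"
  let ?T = "insert t (crossed_points p k)"
  have T: "finite ?T" "?T \<subseteq> {0..1}"
    using crossed_points_finite t by auto
  have "t \<notin> crossed_points p k \<Longrightarrow> weight p k t = 0"
    by (auto simp: weight_def crossed_points_def)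
  then have "(\<Sum>s\<in>?T. weight p k s) = int (5 * k + 2)"
    using sum_weight crossed_points_finite(1) by (cases "t \<in> crossed_points p k") (auto simp: insert_absorb)
  moreover have "(\<Sum>s\<in>?T. weight p k s) < (\<Sum>s\<in>?T. variation p w s)"
    using T(1) less variation_ge_weight[OF w] by (intro sum_strict_mono_ex1) auto
  ultimately show False
    using sum_variation_le_length[OF represents_seesawD(1)[OF w] T] len by simp
qed

text \<open>
  After $x_0^l$ the point $z_{l+1}$ is at $z_1$ and still has to visit $z_0$. The letter $x_i$ moves it off the
  spine, which makes two additional changes of its label necessary. The letter $x_i^{-1}$ moves a point
  \<open>e\<close> between $z_l$ and $z_{l+1}$ onto the right half of the spine; as \<open>e\<close> is to the left of $z_{l+1}$, it
  has to leave this half again before $z_{l+1}$ is at $z_0$, but the weight allows at most one change.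
\<close>
lemma letter_before_gens:
  assumes w: "represents_seesaw p k (u @ [a] @ replicate l (F_gen p 0))"
    and len: "length (u @ [a] @ replicate l (F_gen p 0)) = 5 * k + 2"
    and l: "l < k" and i: "1 \<le> i" "i \<le> p" and a: "a = F_gen p i \<or> a = inv_gen p i"
  shows False
proof -
  let ?v = "replicate l (F_gen p 0)"
  let ?P = "spine p (int (Suc l))" and ?E = "child p (int (Suc l))"
  have vP: "run ?v ?P = spine p 1" "run ?v ?E = child p 1"
    using run_gens(1)[OF unit, of l "int (Suc l)"] run_gens(1)[OF child_unit, of l "int (Suc l)"]
    by (simp_all add: shift_spine shift_child)
  note var = variation_le_weight[OF w len]
  have al: "a \<in> letters p"
    using a i by (auto simp: letters_iff)
  have "child_pair p (run ([a] @ ?v) ?P) (run ([a] @ ?v) ?E)"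
    using child_pair_letter[OF al child_pair_children[of 1]] vP by (simp add: spine_iffs)
  then obtain u1 u2 where u: "u = u1 @ u2" "run u2 (run ([a] @ ?v) ?P) = spine p 0"
    using right_spine_visits_0[of u "[a] @ ?v" "Suc l"] w l by (metis Suc_leI le_add1 plus_1_eq_Suc)
  have u2l: "u2 \<in> lists (letters p)"
    using represents_seesawD(1)[OF w] u(1) by simp
  note gb = gen_spine_1_between[OF i]
  show False
    using a
  proof
    assume a: "a = F_gen p i"
    have "run ([a] @ ?v) ?P = F_gen p i (spine p 1)"
      using vP a by simp
    then have "label p (run ([a] @ ?v) ?P) = 2"
      using labels(2)[of 0] gb by simp
    moreover have "label p (run (u2 @ [a] @ ?v) ?P) = 0"
      using u(2) by (simp add: labels)
    moreover have "label p (run (u1 @ u2 @ [a] @ ?v) ?P) = 1"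
      using represents_seesawD(2)[OF w unit] seesaw_right(1)[of "Suc l"] l u(1) by (simp add: labels)
    ultimately have "4 \<le> variation p (u1 @ (u2 @ [a] @ ?v)) ?P"
      using variation_ge[of p u1 "run (u2 @ [a] @ ?v) ?P"] variation_ge[of p u2 "run ([a] @ ?v) ?P"]
        variation_ge[of p "[a] @ ?v" ?P] unfolding variation_append[of p u1] variation_append[of p u2]
      by (simp add: labels)
    moreover have "weight p k ?P \<le> 2"
      by (simp add: weight_def)
    ultimately show False
      using var[OF unit[of "int (Suc l)"]] u(1) by simp
  next
    assume a: "a = inv_gen p i"
    define e where "e = shift p (int l) (F_gen p i (spine p 1))"
    have e: "e \<in> {0..1}" "spine p (int l) < e" "e < spine p (int l + 1)"
      unfolding e_def using shift_between[OF gb] shift_unit gb unit[of 0] unit[of 1] by auto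
    have "F_gen p i (spine p 1) \<in> {0..1}"
      using gb unit[of 0] unit[of 1] by auto
    then have "run ?v e = F_gen p i (spine p 1)"
      unfolding e_def using run_gens_shift(1)[of _ l "int l"] shift_0 by simp
    then have ae: "run ([a] @ ?v) e = spine p 1"
      using a gen_inv_gen(2)[OF i(2) unit] by simp
    have aP: "run ([a] @ ?v) ?P = spine p 2"
      using vP a inv_gen_high[OF i unit, of 1] by (simp add: shift_spine)
    have "run u2 (spine p 1) < run u2 (spine p 2)"
      using run_less[OF u2l unit unit] by (simp add: spine_iffs)
    then have "run (u2 @ [a] @ ?v) e < spine p 0"
      using u(2) ae aP by simp
    then have "label p (run (u2 @ [a] @ ?v) e) \<noteq> 1"
      using label_1_ge[of "run (u2 @ [a] @ ?v) e"] spine_iffs(1)[of 0 1] by auto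
    moreover have "label p (run ([a] @ ?v) e) = 1"
      using ae by (simp add: labels)
    moreover have "label p e = 2"
      using labels(2) e by blast
    ultimately have "2 \<le> variation p (u1 @ (u2 @ [a] @ ?v)) e"
      using variation_nonneg[of p u1 "run (u2 @ [a] @ ?v) e"] variation_visit[of p "[a] @ ?v" e u2]
      unfolding variation_append[of p u1] by auto
    moreover have "weight p k e \<le> 1"
    proof -
      have "e \<noteq> spine p m" for m
        using \<open>label p e = 2\<close> labels(1)[of m] by (auto split: if_splits)
      moreover have "e \<noteq> child p (- int k)"
        using child_between(2)[of "- int k"] e(2) spine_iffs(2)[of "1 - int k" "int l"] l by auto
      ultimately show ?thesis
        by (auto simp: weight_def)
    qed
    ultimately show False
      using var[OF e(1)] u(1) by simp
  qed
qed

text \<open>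
  After $x_0^{-l}$ the point $z_{1-l}$ is at $z_1$ and has to return to the left half of the spine. The letter $x_i$
  moves it off the spine, which makes two additional changes necessary. The letter $x_i^{-1}$ moves a
  point \<open>e\<close> between $z_{-l}$ and $z_{1-l}$ onto the spine, but \<open>e\<close> is fixed by the seesaw element and
  has weight \<open>0\<close>. The bound on \<open>l\<close> keeps both points to the right of the support of the left word.
\<close>
lemma letter_before_inv_gens:
  assumes w: "represents_seesaw p k (u @ [a] @ replicate l (inv_gen p 0))"
    and len: "length (u @ [a] @ replicate l (inv_gen p 0)) = 5 * k + 2"
    and l: "1 \<le> l" "l + 3 \<le> k" and i: "1 \<le> i" "i \<le> p" and a: "a = F_gen p i \<or> a = inv_gen p i"
  shows False
proof -
  let ?v = "replicate l (inv_gen p 0)"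
  note var = variation_le_weight[OF w len]
  note gb = gen_spine_1_between[OF i]
  show False
    using a
  proof
    assume a: "a = F_gen p i"
    let ?P = "spine p (1 - int l)"
    have vP: "run ?v ?P = spine p 1"
      using run_gens(2)[OF unit, of l "1 - int l"] by (simp add: shift_spine)
    have "label p (run ([a] @ ?v) ?P) = 2"
      using vP a labels(2)[of 0] gb by simp
    moreover have "label p (run (u @ [a] @ ?v) ?P) = 0"
    proof -
      have "run (seesaw_word p k) ?P = ?P"
        using l by (intro seesaw_fixed) (auto simp: spine_iffs)
      then show ?thesis
        using represents_seesawD(2)[OF w unit, of "1 - int l"] l by (simp add: labels)
    qed
    ultimately have "4 \<le> variation p (u @ [a] @ ?v) ?P"
      using variation_ge[of p u "run ([a] @ ?v) ?P"] variation_visit[of p ?v ?P "[a]"] vP l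
      unfolding variation_append[of p u] by (simp add: labels)
    moreover have "weight p k ?P \<le> 2"
      by (simp add: weight_def)
    ultimately show False
      using var[OF unit[of "1 - int l"]] by simp
  next
    assume a: "a = inv_gen p i"
    define e where "e = shift p (- int l) (F_gen p i (spine p 1))"
    have "F_gen p i (spine p 1) \<in> {0..1}"
      using gb unit[of 0] unit[of 1] by auto
    then have e: "e \<in> {0..1}" "spine p (- int l) < e" "e < spine p (- int l + 1)"
      unfolding e_def using shift_between[OF gb, of "- int l"] shift_unit by blast+
    have "F_gen p i (spine p 1) \<in> {0..1}"
      using gb unit[of 0] unit[of 1] by auto
    then have "run ?v e = F_gen p i (spine p 1)"
      unfolding e_def using run_gens_shift(2)[of _ l "- int l"] shift_0 by simp
    then have ae: "label p (run ([a] @ ?v) e) = 1"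
      using a gen_inv_gen(2)[OF i(2) unit] by (simp add: labels)
    have le: "label p e = 2"
      using labels(2) e by blast
    have "spine p (3 - int k) \<le> spine p (- int l)" "spine p (- int l + 1) \<le> spine p 1"
      using l by (auto simp: spine_iffs)
    then have "run (seesaw_word p k) e = e"
      using e by (intro seesaw_fixed) auto
    then have "run (u @ [a] @ ?v) e = e"
      using represents_seesawD(2)[OF w e(1)] by simp
    then have "2 \<le> variation p (u @ [a] @ ?v) e"
      using variation_visit[of p "[a] @ ?v" e u] ae le by auto
    moreover have "weight p k e = 0"
    proof -
      have "e \<noteq> spine p m" for m
        using le labels(1)[of m] by (auto split: if_splits)
      then have "e \<notin> spine p ` {1 - int k..int k}"
        by blast
      moreover have ne: "e \<noteq> child p m" if "m \<le> - int k \<or> 1 \<le> m" for m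
        using child_between[of m] e spine_iffs(2)[of "m + 1" "- int l"]
          spine_iffs(2)[of "- int l + 1" m] l that by auto
      have "e \<noteq> child p (- int k)" "e \<notin> child p ` {1..int k}"
        using ne by (simp, metis atLeastAtMost_iff imageE)
      ultimately show ?thesis
        by (simp add: weight_def)
    qed
    ultimately show False
      using var[OF e(1)] by simp
  qed
qed

lemma cancel_pair:
  assumes w: "represents_seesaw p k (u @ [a, b] @ v)" and ba: "\<And>t. t \<in> {0..1} \<Longrightarrow> a (b t) = t"
    and len: "length (u @ [a, b] @ v) = 5 * k + 2"
  shows False
proof -
  have l: "u @ v \<in> lists (letters p)" "v \<in> lists (letters p)"
    using represents_seesawD(1)[OF w] by auto
  have "run (u @ v) t = run (u @ [a, b] @ v) t" if "t \<in> {0..1}" for t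
    using ba[OF run_unit[OF l(2) that]] by simp
  then have "represents_seesaw p k (u @ v)"
    using represents_seesawD(2)[OF w] l(1) unfolding represents_seesaw_def by simp
  then show False
    using length_ge[of "u @ v"] len by simp
qed

text \<open>
  By induction the final power of $x_0^{\pm 1}$ can be extended to the left: other generators are excluded by the
  previous lemmas, and the inverse of the repeated letter would cancel.
\<close>
lemma geodesic_suffix:
  assumes w: "represents_seesaw p k w" and len: "length w = 5 * k + 2"
  obtains u a where "a = F_gen p 0 \<or> a = inv_gen p 0" "w = u @ replicate (k - 2) a"
proof -
  have "\<exists>u a. (a = F_gen p 0 \<or> a = inv_gen p 0) \<and> w = u @ replicate l a" if "l \<le> k - 2" for l
    using that
  proof (induction l)
    case 0
    then show ?case by auto
  next
    case (Suc l)
    then obtain u a where a: "a = F_gen p 0 \<or> a = inv_gen p 0" and wu: "w = u @ replicate l a"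
      by auto
    have "u \<noteq> []"
      using wu len Suc.prems by auto
    then obtain u' c where u: "u = u' @ [c]"
      by (metis rev_exhaust)
    have wc: "w = u' @ [c] @ replicate l a"
      using wu u by simp
    then have "c \<in> letters p"
      using represents_seesawD(1)[OF w] by simp
    then obtain i where i: "i \<le> p" "c = F_gen p i \<or> c = inv_gen p i"
      by (auto simp: letters_iff)
    have l: "l < k" "l + 3 \<le> k"
      using Suc.prems k by auto
    have i0: "i = 0"
    proof (rule ccontr)
      assume "i \<noteq> 0"
      then have i1: "1 \<le> i" by simp
      show False
      proof (cases "l = 0")
        case True
        then show ?thesis
          using letter_before_gens[of u' c 0, OF _ _ _ i1 i] w len wc k by simp
      next
        case False
        then show ?thesis
          using a letter_before_gens[of u' c l, OF _ _ l(1) i1 i]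
            letter_before_inv_gens[of u' c l, OF _ _ _ l(2) i1 i] w len wc by auto
      qed
    qed
    have "c = a \<or> l = 0"
    proof (rule ccontr)
      assume "\<not> (c = a \<or> l = 0)"
      then obtain m where m: "l = Suc m" and ca: "c \<noteq> a" by (cases l) auto
      have "c (a t) = t" if "t \<in> {0..1}" for t
        using gen_inv_gen[of 0 t] that a i(2) i0 ca by auto
      then show False
        using cancel_pair[of u' c a "replicate m a"] w len wc m by simp
    qed
    then have "w = u' @ replicate (Suc l) c"
      using wc by (auto simp: replicate_append_same)
    then show ?case
      using i i0 by blast
  qed
  from this[of "k - 2"] show ?thesis
    using that by auto
qed

text \<open>
  Of the two words for the seesaw element, take the one that ends in the power of the inverse of \<open>a\<close>, and
  cancel \<open>d\<close> letters.
\<close>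
lemma seesaw_alternative:
  assumes a: "a = F_gen p 0 \<or> a = inv_gen p 0" and d: "d \<le> k - 1"
  obtains v where "v \<in> lists (letters p)" "length v = 5 * k + 2 - d"
    "\<forall>t\<in>{0..1}. run v t = run (seesaw_word p k @ replicate d a) t"
proof -
  define b where "b = (if a = F_gen p 0 then inv_gen p 0 else F_gen p 0)"
  have ba: "b (a t) = t" if "t \<in> {0..1}" for t
    using a gen_inv_gen[of 0 t] that by (auto simp: b_def)
  have al: "a \<in> letters p" "b \<in> letters p"
    using a by (auto simp: letters_iff b_def)
  have cancel: "run (replicate d b) (run (replicate d a) t) = t" if "t \<in> {0..1}" for t
    using that
  proof (induction d arbitrary: t)
    case (Suc d)
    have "a t \<in> {0..1}"
      using run_unit[OF _ Suc.prems, of "[a]"] al by simp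
    moreover have "run (replicate (Suc d) a) t = run (replicate d a) (a t)"
      by (simp add: funpow_swap1)
    ultimately show ?case
      using Suc.IH ba[OF Suc.prems] by simp
  qed simp
  have "\<exists>v1 m. v1 @ replicate m b \<in> lists (letters p) \<and> length (v1 @ replicate m b) = 5 * k + 2 \<and>
      m \<ge> k - 1 \<and> (\<forall>t\<in>{0..1}. run (v1 @ replicate m b) t = run (seesaw_word p k) t)"
  proof (cases "a = F_gen p 0")
    case True
    let ?v = "right_word p k @ replicate k (F_gen p 0) @ [inv_gen p 1, inv_gen p 0, F_gen p 1]"
    have v: "right_word p k @ left_word p k = ?v @ replicate (k - 1) b"
      using True by (simp add: left_word_def b_def)
    have "?v @ replicate (k - 1) b \<in> lists (letters p)"
      unfolding v[symmetric] using left_word_letters right_word_letters by simp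
    moreover have "length (?v @ replicate (k - 1) b) = 5 * k + 2"
      unfolding v[symmetric] using length_words[of k] k by simp
    moreover have "run (?v @ replicate (k - 1) b) t = run (seesaw_word p k) t" if "t \<in> {0..1}" for t
      unfolding v[symmetric] seesaw_word_def using words_commute[OF that] k by simp
    ultimately show ?thesis by blast
  next
    case False
    let ?v = "left_word p k @ concat (replicate k [inv_gen p 0, inv_gen p 1])"
    have v: "seesaw_word p k = ?v @ replicate k b"
      using False by (simp add: seesaw_word_def right_word_def b_def)
    show ?thesis
      using v seesaw_word_letters length_seesaw_word by (intro exI[of _ ?v] exI[of _ k]) simp
  qed
  then obtain v1 m where v1: "v1 @ replicate m b \<in> lists (letters p)"
      "length (v1 @ replicate m b) = 5 * k + 2" "m \<ge> k - 1"
      "\<And>t. t \<in> {0..1} \<Longrightarrow> run (v1 @ replicate m b) t = run (seesaw_word p k) t"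
    by blast
  obtain r where r: "m = r + d"
    using d v1(3) by (metis add.commute le_Suc_ex le_trans)
  show ?thesis
  proof (rule that[of "v1 @ replicate r b"])
    show "v1 @ replicate r b \<in> lists (letters p)" "length (v1 @ replicate r b) = 5 * k + 2 - d"
      using v1(1,2) al by (auto simp: r in_lists_conv_set)
    have "run (v1 @ replicate r b) t = run (seesaw_word p k @ replicate d a) t" if t: "t \<in> {0..1}" for t
    proof -
      have "run (replicate d a) t \<in> {0..1}"
        using run_unit[OF _ t, of "replicate d a"] al by (auto simp: in_lists_conv_set)
      then show ?thesis
        using v1(4)[of "run (replicate d a) t"] cancel[OF t] by (simp add: r replicate_add)
    qed
    then show "\<forall>t\<in>{0..1}. run (v1 @ replicate r b) t = run (seesaw_word p k @ replicate d a) t"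
      by blast
  qed
qed

end

end

section \<open>Pumping\<close>

lemma word_length_le:
  assumes "v \<in> lists (letters p)"
  shows "word_length (F_group (p + 1)) (F_gens p) (word_value (F_group (p + 1)) v) \<le> length v"
  unfolding word_length_def using assms by (intro Least_le) (auto simp: letters_def)

text \<open>
  Among the first states reached within the final power of \<open>a\<close>, two coincide by the pigeonhole principle;
  the part in between can be repeated. \<open>K\<close> is the number of states.
\<close>
lemma regular_language_pumping:
  assumes "regular_language A L"
  obtains K :: nat where "\<And>u a m. u @ replicate m a \<in> L \<Longrightarrow> K \<le> m \<Longrightarrow>
    \<exists>d. 1 \<le> d \<and> d \<le> K \<and> u @ replicate (m + d) a \<in> L"
proof -
  obtain Q :: "nat set" and q0 \<delta> Acc where Q: "finite Q" "q0 \<in> Q" "\<forall>q\<in>Q. \<forall>a\<in>A. \<delta> q a \<in> Q"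
      and L: "L = {w \<in> lists A. foldl \<delta> q0 w \<in> Acc}"
    using assms unfolding regular_language_def by blast
  have state: "foldl \<delta> q0 w \<in> Q" if "w \<in> lists A" for w
    using that by (induction w rule: rev_induct) (use Q in auto)
  have "\<exists>d. 1 \<le> d \<and> d \<le> card Q \<and> u @ replicate (m + d) a \<in> L"
    if w: "u @ replicate m a \<in> L" and m: "card Q \<le> m" for u a m
  proof -
    let ?s = "\<lambda>i. foldl \<delta> q0 (u @ replicate i a)"
    have uA: "u \<in> lists A" "m = 0 \<or> a \<in> A"
      using w L by (auto simp: in_lists_conv_set)
    have "card Q \<noteq> 0"
      using Q by auto
    then have aA: "a \<in> A" using uA m by auto
    have "u @ replicate i a \<in> lists A" for i
      using uA aA by (auto simp: in_lists_conv_set)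
    then have "?s ` {0..card Q} \<subseteq> Q"
      using state by blast
    then have "card (?s ` {0..card Q}) \<le> card Q"
      using Q(1) card_mono by blast
    then have "\<not> inj_on ?s {0..card Q}"
      using card_image[of ?s "{0..card Q}"] by auto
    then obtain i j where ij: "i < j" "j \<le> card Q" "?s i = ?s j"
      unfolding inj_on_def by (metis atLeastAtMost_iff linorder_neqE_nat)
    have split: "foldl \<delta> q0 (u @ replicate (l + (m - i)) a) = foldl \<delta> (?s l) (replicate (m - i) a)" for l
      by (simp add: replicate_add)
    have "m + (j - i) = j + (m - i)" "m = i + (m - i)"
      using ij m by auto
    then have "foldl \<delta> q0 (u @ replicate (m + (j - i)) a) = foldl \<delta> (?s j) (replicate (m - i) a)"
      using split[of j] by (simp only:)
    also have "\<dots> = foldl \<delta> (?s i) (replicate (m - i) a)"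
      using ij by simp
    also have "\<dots> = foldl \<delta> q0 (u @ replicate m a)"
      using split[of i] ij m by simp
    finally have "u @ replicate (m + (j - i)) a \<in> L"
      using w L uA aA by (auto simp: in_lists_conv_set)
    then show ?thesis
      using ij by (intro exI[of _ "j - i"]) auto
  qed
  then show ?thesis using that by blast
qed

theorem corollary2p2:
  fixes p :: nat
  assumes "p \<ge> 1"
  shows "\<not> (\<exists>L. regular_language (sym_gens (F_group (p + 1)) (F_gens p)) L \<and>
               (\<forall>w\<in>L. geodesic_word (F_group (p + 1)) (F_gens p) w) \<and>
               (\<forall>g\<in>carrier (F_group (p + 1)). \<exists>w\<in>L. word_value (F_group (p + 1)) w = g))"
proof
  let ?G = "F_group (p + 1)" and ?X = "F_gens p"
  assume "\<exists>L. regular_language (sym_gens ?G ?X) L \<and> (\<forall>w\<in>L. geodesic_word ?G ?X w) \<and>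
               (\<forall>g\<in>carrier ?G. \<exists>w\<in>L. word_value ?G w = g)"
  then obtain L where L: "regular_language (sym_gens ?G ?X) L" "\<And>w. w \<in> L \<Longrightarrow> geodesic_word ?G ?X w"
      "\<And>g. g \<in> carrier ?G \<Longrightarrow> \<exists>w\<in>L. word_value ?G w = g"
    by blast
  obtain K where K: "\<And>u a m. u @ replicate m a \<in> L \<Longrightarrow> K \<le> m \<Longrightarrow>
      \<exists>d. 1 \<le> d \<and> d \<le> K \<and> u @ replicate (m + d) a \<in> L"
    using regular_language_pumping[OF L(1)] by blast
  \<comment> \<open>The final power in \<open>geodesic_suffix\<close> has length $k - 2$, which must be at least \<open>K\<close>.\<close>
  define k where "k = K + 3"
  have k: "k \<ge> 3" "K \<le> k - 2" by (auto simp: k_def)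
  interpret thompson_group p
    using assms by unfold_locales
  note adic = word_adic
  note eq_iff = word_value_eq_iff[where n = "p + 1"]
  let ?f = "word_value ?G (seesaw_word p k)"
  have geo: "w \<in> lists (letters p)" "length w = word_length ?G ?X (word_value ?G w)" if "w \<in> L" for w
    using L(2)[OF that] by (auto simp: geodesic_word_def letters_def)
  have "?f \<in> carrier ?G"
    using word_value_F_group[OF adic[OF seesaw_word_letters[OF k(1)]]] F_adicD(1) by simp
  then obtain w where w: "w \<in> L" "word_value ?G w = ?f"
    using L(3) by blast
  have rep: "represents_seesaw p k w"
    using eq_iff[OF adic[OF geo(1)[OF w(1)]] adic[OF seesaw_word_letters[OF k(1)]]] w geo
    by (simp add: represents_seesaw_def)
  have "length w \<le> 5 * k + 2"
    using geo(2)[OF w(1)] word_length_le[OF seesaw_word_letters[OF k(1)]] w(2)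
      length_seesaw_word[OF k(1)] by simp
  then have len: "length w = 5 * k + 2"
    using length_ge[OF k(1) rep] by simp
  obtain u a where a: "a = F_gen p 0 \<or> a = inv_gen p 0" and wu: "w = u @ replicate (k - 2) a"
    using geodesic_suffix[OF k(1) rep len] .
  obtain d where d: "1 \<le> d" "d \<le> K" "u @ replicate (k - 2 + d) a \<in> L"
    using K[of u "k - 2" a] w(1) wu k(2) by auto
  have w': "w @ replicate d a \<in> L"
    using d(3) wu by (simp add: replicate_add)
  have dk: "d \<le> k - 1"
    using d k by simp
  obtain v where v: "v \<in> lists (letters p)" "length v = 5 * k + 2 - d"
      "\<forall>t\<in>{0..1}. run v t = run (seesaw_word p k @ replicate d a) t"
    using seesaw_alternative[OF k(1) a dk] .
  have "run v t = run (w @ replicate d a) t" if "t \<in> {0..1}" for t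
  proof -
    have "replicate d a \<in> lists (letters p)"
      using geo(1)[OF w'] by simp
    then have "run (replicate d a) t \<in> {0..1}"
      using run_unit[OF _ that] by blast
    then show ?thesis
      using v(3) that rep by (simp add: represents_seesaw_def)
  qed
  then have "word_value ?G v = word_value ?G (w @ replicate d a)"
    using eq_iff[OF adic[OF v(1)] adic[OF geo(1)[OF w']]] by simp
  then have "length (w @ replicate d a) \<le> length v"
    using geo(2)[OF w'] word_length_le[OF v(1)] by simp
  then show False
    using v(2) len d(1) by simp
qed

end
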